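(* Let $r \geq 4$ be an integer, and set $\tau = \binom{r}{2}-1$. For every $n$ with $\log\log n \geq 3\log\tau$ let $t = t(n)$ be an integer with $1 \leq t(n) \leq \frac{\log\log n}{3\log\tau}$. Put $e_t = \tau^t$ and $v_t = (r-2)\frac{\tau^t-1}{\tau-1}+2$. Let $(p_n)$ be a sequence of probabilities ($p_n\in[0,1]$), let $\omega(n)$ be a positive function with $\omega(n)\to\infty$ as $n \to \infty$, and let $T = T(n,r,G_{n,p_n})$ be the percolation time of the $K_r$-bootstrap process on $K_n$ started from the random graph $G_{n,p_n}$. Then: (i) if, for all such $n$, $p_n \geq n^{-(v_t-2)/e_t}\log n$, then $\mathbb{P}_{p_n}(T \leq t) \to 1$ as $n\to\infty$; and (ii) if, for all such $n$, $p_n \leq n^{-(v_t-2)/e_t}/\omega(n)$, then $\mathbb{P}_{p_n}(T\leq t)\to 0$ as $n\to\infty$. Here $t=t(n)$ throughout.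
   Context: $\log$ is the natural logarithm. $G_{n,p}$ is the Erdős–Rényi random graph on vertex set $[n]$, in which each edge of $K_n$ is present independently with probability $p$; $\mathbb{P}_p$ is the corresponding probability measure. The $K_r$-bootstrap process on $K_n$ started from a graph $G\subseteq K_n$ (with vertex set $[n]$) is the sequence $G_0 = G$ and, for $s = 0,1,2,\dots$, $G_{s+1} = G_s \cup \{e \in E(K_n) : \text{there is a copy } H \text{ of } K_r \text{ with } e\in H \subseteq G_s\cup\{e\}\}$. The percolation time is $T(n,r,G_0) = \min\{s \geq 0 : G_s = K_n\}$ (with $T=\infty$ if no such $s$ exists). *)

theory Defs
  imports "HOL-Probability.Probability"
begin

text \<open>A graph on a known vertex set is represented by its set of edges, an edge being a
  two-element set of vertices.\<close>

definition complete_graph :: "'a set \<Rightarrow> 'a set set" where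
  "complete_graph V = {e. e \<subseteq> V \<and> card e = 2}"

abbreviation K :: "nat \<Rightarrow> nat set set" where
  "K n \<equiv> complete_graph {1..n}"

text \<open>A copy of $K_r$ in $K_n$ is the complete graph on an $r$-element set of vertices.\<close>

definition clique_copies :: "nat \<Rightarrow> nat \<Rightarrow> nat set set set" where
  "clique_copies n r = {complete_graph W | W. W \<subseteq> {1..n} \<and> card W = r}"

definition bootstrap_step :: "nat \<Rightarrow> nat \<Rightarrow> nat set set \<Rightarrow> nat set set" where
  "bootstrap_step n r G =
     G \<union> {e \<in> K n. \<exists>H \<in> clique_copies n r. e \<in> H \<and> H \<subseteq> G \<union> {e}}"

definition bootstrap :: "nat \<Rightarrow> nat \<Rightarrow> nat set set \<Rightarrow> nat \<Rightarrow> nat set set" where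
  "bootstrap n r G s = (bootstrap_step n r ^^ s) G"

text \<open>The infimum of the empty set is \<open>\<infinity>\<close> in \<^typ>\<open>enat\<close>, which covers the case
  that the process never reaches $K_n$; otherwise the infimum is attained.\<close>

definition percolation_time :: "nat \<Rightarrow> nat \<Rightarrow> nat set set \<Rightarrow> enat" where
  "percolation_time n r G = Inf {enat s | s. bootstrap n r G s = K n}"

text \<open>One independent Bernoulli variable per edge of $K_n$; the second argument of
  \<^const>\<open>Pi_pmf\<close> is only the dummy value taken outside the index set.\<close>

definition random_graph :: "nat \<Rightarrow> real \<Rightarrow> nat set set pmf" where
  "random_graph n p =
     map_pmf (\<lambda>X. {e \<in> K n. X e}) (Pi_pmf (K n) False (\<lambda>_. bernoulli_pmf p))"

definition tau :: "nat \<Rightarrow> real" where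
  "tau r = real (r choose 2) - 1"

definition e_num :: "nat \<Rightarrow> nat \<Rightarrow> real" where
  "e_num r t = tau r ^ t"

definition v_num :: "nat \<Rightarrow> nat \<Rightarrow> real" where
  "v_num r t = (real r - 2) * ((tau r ^ t - 1) / (tau r - 1)) + 2"

text \<open>Since \<open>tau r \<ge> 5\<close> for \<open>r \<ge> 4\<close>, this excludes all small \<open>n\<close> for which the iterated
  logarithm is undefined and \<^const>\<open>ln\<close> takes a conventional value.\<close>

definition admissible :: "nat \<Rightarrow> nat \<Rightarrow> bool" where
  "admissible r n \<longleftrightarrow> ln (ln (real n)) \<ge> 3 * ln (tau r)"

end

theory Submission
  imports Defs "HOL-Real_Asymp.Real_Asymp"
begin

text \<open>Write $\tau = \binom r2 - 1$, $a = (\tau-1)/(r-2)$, so that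
  $(v_t-2)/e_t = (1-\tau^{-t})/a$.

  For (ii), an edge $e$ present after $t$ steps is derived from some $F \subseteq G_0$ with
  $|F| \le \tau^t$. If $|F| = \tau^t$, then $F$ is one of at most $n^{v_t-2}$ unfoldings of $e$.
  Otherwise consider the bound $|F[U]| \le a(|U|-2)+1$ on vertex sets $U$: it is attained by a $K_r$
  minus an edge, so that tight vertex sets propagate along the process and some $U \supseteq e$
  has $|F[U]| \ge a(|U|-2)+1$. As $|F[U]| < \tau^t$, such dense spots cost a factor
  $n^{-1/(a\tau^t)}$, which beats the number of their shapes because
  $\tau^t \le (\log n)^{1/3}$.

  For (i), the complete unfolding of an edge is a rooted graph with $\tau^t$ edges and $v_t-2$ new
  vertices which is strictly balanced up to a gap of order $\tau^{-t}$. Inside a set of about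
  $n/(3\log n)$ vertices, the second moment method yields a copy rooted at a given edge with
  probability at least $1-e^{-1}$. About $3 \log n$ disjoint vertex sets provide independent
  attempts, so that no copy exists with probability at most $n^{-3}$, and a union bound over the
  edges finishes the proof.\<close>

subsection \<open>The bootstrap process\<close>

text \<open>Let m = tau^t and p = n^(-(1-1/m)/a). A set of u vertices around an edge carrying k >=
  a(u-2)+1 edges has expected number about n^(u-2) p^k, whose exponent is at most (k-m)/(am). This
  is at most -1/(am) for k < m and can vanish at k = m. So complete unfoldings are exactly critical:
  they are counted by their shape, with omega(n) as the only gain. Anything smaller is handled by
  density alone, without classifying how a derivation may overlap itself. The second moment in (i)
  mirrors this. A proper overlap of two copies gains n^(-1/(am)), while total overlap gains only
  (log n)^(-m), from the logarithm in p. Shrinking the vertex sets to order n/log n costs a factor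
  (log n)^(v_t-2) up to lower powers, and v_t-2 <= m/2 because a >= 2. This margin between m/2 and m
  is what lets one logarithm pay for logarithmically many independent attempts. In both parts an
  entropy term of order m log log n must stay below (log n)/(am), which m <= (log n)^(1/3)
  ensures.\<close>

lemma complete_graph_mono: "A \<subseteq> B \<Longrightarrow> complete_graph A \<subseteq> complete_graph B"
  by (auto simp: complete_graph_def)

lemma finite_complete_graph [simp]: "finite A \<Longrightarrow> finite (complete_graph A)"
  by (auto simp: complete_graph_def)

lemma card_complete_graph: "finite A \<Longrightarrow> card (complete_graph A) = card A choose 2"
  by (simp add: complete_graph_def n_subsets)

lemma bootstrap_0 [simp]: "bootstrap n r G 0 = G"
  by (simp add: bootstrap_def)

lemma bootstrap_Suc: "bootstrap n r G (Suc s) = bootstrap_step n r (bootstrap n r G s)"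
  by (simp add: bootstrap_def)

lemma mono_bootstrap: "mono (bootstrap n r G)"
  by (rule mono_iff_le_Suc[THEN iffD2]) (auto simp: bootstrap_Suc bootstrap_step_def)

lemma bootstrap_step_mono: "G \<subseteq> G' \<Longrightarrow> bootstrap_step n r G \<subseteq> bootstrap_step n r G'"
  unfolding bootstrap_step_def by blast

lemma bootstrap_mono: "G \<subseteq> G' \<Longrightarrow> bootstrap n r G s \<subseteq> bootstrap n r G' s"
  by (induction s) (simp_all add: bootstrap_Suc bootstrap_step_mono)

lemma bootstrap_subset_K: "G \<subseteq> K n \<Longrightarrow> bootstrap n r G s \<subseteq> K n"
  by (induction s) (auto simp: bootstrap_Suc bootstrap_step_def)

text \<open>A finite infimum in \<open>enat\<close> is attained, and the process increases inside
  \<open>K n\<close>, so a complete graph reached earlier persists until step \<open>t\<close>.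
  Afterwards only fixed-time events have to be estimated.\<close>

lemma percolation_time_le_iff:
  assumes "G \<subseteq> K n"
  shows "percolation_time n r G \<le> enat t \<longleftrightarrow> bootstrap n r G t = K n"
proof
  let ?S = "{enat s | s. bootstrap n r G s = K n}"
  assume le: "percolation_time n r G \<le> enat t"
  then have "?S \<noteq> {}"
    by (auto simp: percolation_time_def Inf_enat_def split: if_splits)
  then have "percolation_time n r G \<in> ?S"
    unfolding percolation_time_def Inf_enat_def using LeastI_ex[of "\<lambda>x. x \<in> ?S"] by auto
  then obtain s where "percolation_time n r G = enat s" "bootstrap n r G s = K n"
    by blast
  with le have "K n \<subseteq> bootstrap n r G t"
    using monoD[OF mono_bootstrap, of s t n r G] by simp
  then show "bootstrap n r G t = K n"
    using bootstrap_subset_K[OF assms] by blast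
qed (auto simp: percolation_time_def intro: Inf_lower)

lemma bootstrap_SucE:
  assumes "e \<in> bootstrap n r G (Suc s)"
  obtains "e \<in> bootstrap n r G s"
  | W where "W \<subseteq> {1..n}" "card W = r" "e \<in> complete_graph W" "e \<in> K n"
      "complete_graph W - {e} \<subseteq> bootstrap n r G s"
  using assms unfolding bootstrap_Suc bootstrap_step_def clique_copies_def by blast

lemma bootstrap_SucI:
  assumes "W \<subseteq> {1..n}" "card W = r" "e \<in> complete_graph W"
    "complete_graph W - {e} \<subseteq> bootstrap n r G s"
  shows "e \<in> bootstrap n r G (Suc s)"
proof -
  have "e \<in> K n" using assms complete_graph_mono by blast
  with assms show ?thesis
    unfolding bootstrap_Suc bootstrap_step_def clique_copies_def by blast
qed

subsection \<open>Tight vertex sets\<close>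

definition induced :: "'a set set \<Rightarrow> 'a set \<Rightarrow> 'a set set" where
  "induced F U = {f \<in> F. f \<subseteq> U}"

text \<open>For \<open>a = (\<tau> - 1) / (r - 2)\<close> this is the largest affine bound with value 1 at \<open>u = 2\<close>
  that does not exceed \<open>\<tau>\<close> at \<open>u = r\<close>: a clique minus one edge is already tight.\<close>

definition sparse_bound :: "real \<Rightarrow> nat \<Rightarrow> real" where
  "sparse_bound a u = a * (real u - 2) + 1"

definition sparse_weight :: "real \<Rightarrow> 'a set \<Rightarrow> 'a set set \<Rightarrow> ('a set \<Rightarrow> real) \<Rightarrow> bool" where
  "sparse_weight a A F w \<longleftrightarrow> (\<forall>f\<in>F. 0 \<le> w f) \<and>
     (\<forall>U\<subseteq>A. 2 \<le> card U \<longrightarrow> sum w (induced F U) \<le> sparse_bound a (card U))"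

definition tight :: "real \<Rightarrow> 'a set \<Rightarrow> 'a set set \<Rightarrow> ('a set \<Rightarrow> real) \<Rightarrow> 'a set \<Rightarrow> bool" where
  "tight a A F w U \<longleftrightarrow> U \<subseteq> A \<and> 2 \<le> card U \<and> sum w (induced F U) = sparse_bound a (card U)"

text \<open>Fractional weights are needed because \<open>a\<close> need not be an integer. They are chosen greedily:
  each new edge gets the smallest slack among the vertex sets containing it.\<close>

lemma exists_maximal_sparse_weight:
  assumes "finite F" "F \<subseteq> complete_graph A" "finite A" "a \<ge> 0"
  shows "\<exists>w. sparse_weight a A F w \<and> (\<forall>f\<in>F. \<exists>U. f \<subseteq> U \<and> tight a A F w U)"
  using assms(1,2)
proof (induction F)
  case empty
  then show ?case using assms(4)
    by (auto simp: sparse_weight_def induced_def sparse_bound_def)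
next
  case (insert f F)
  then obtain w where w: "sparse_weight a A F w" "\<forall>f\<in>F. \<exists>U. f \<subseteq> U \<and> tight a A F w U"
    by auto
  have f: "f \<subseteq> A" "card f = 2" using insert.prems by (auto simp: complete_graph_def)
  define slack where "slack U = sparse_bound a (card U) - sum w (induced F U)" for U
  define \<U> where "\<U> = {U. f \<subseteq> U \<and> U \<subseteq> A}"
  have fin: "finite \<U>" "f \<in> \<U>" using assms(3) f by (auto simp: \<U>_def)
  have c2: "2 \<le> card U" if "U \<in> \<U>" for U
    using that f assms(3) by (metis (mono_tags, lifting) \<U>_def card_mono finite_subset mem_Collect_eq)
  define x where "x = Min (slack ` \<U>)"
  have x_le: "x \<le> slack U" if "U \<in> \<U>" for U using fin that by (auto simp: x_def)
  have "x \<in> slack ` \<U>" unfolding x_def using fin by (intro Min_in) auto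
  then obtain U0 where U0: "U0 \<in> \<U>" "x = slack U0" by auto
  have x0: "x \<ge> 0" using U0 c2[OF U0(1)] w(1) by (auto simp: slack_def sparse_weight_def \<U>_def)
  define w' where "w' = w(f := x)"
  have sum_w': "sum w' (induced (insert f F) U) = sum w (induced F U) + (if f \<subseteq> U then x else 0)" for U
  proof -
    have "sum w' (induced F U) = sum w (induced F U)"
      using insert.hyps by (intro sum.cong) (auto simp: w'_def induced_def)
    moreover have "induced (insert f F) U = (if f \<subseteq> U then insert f (induced F U) else induced F U)"
      by (auto simp: induced_def)
    moreover have "finite (induced F U)" "f \<notin> induced F U"
      using insert.hyps by (auto simp: induced_def)
    ultimately show ?thesis by (auto simp: w'_def)
  qed
  have "sparse_weight a A (insert f F) w'"
    unfolding sparse_weight_def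
  proof (intro conjI ballI allI impI)
    fix g assume "g \<in> insert f F" then show "0 \<le> w' g"
      using w(1) x0 by (auto simp: w'_def sparse_weight_def)
  next
    fix U assume U: "U \<subseteq> A" "2 \<le> card U"
    then show "sum w' (induced (insert f F) U) \<le> sparse_bound a (card U)"
      using w(1) x_le[of U] unfolding sum_w'
      by (auto simp: slack_def sparse_weight_def \<U>_def)
  qed
  moreover have "\<exists>U. g \<subseteq> U \<and> tight a A (insert f F) w' U" if "g \<in> insert f F" for g
  proof (cases "g = f")
    case True
    then show ?thesis using U0 c2 sum_w'
      by (intro exI[of _ U0]) (auto simp: tight_def \<U>_def slack_def)
  next
    case False
    with that w(2) obtain U where U: "g \<subseteq> U" "tight a A F w U" by auto
    \<comment> \<open>A set that was already tight has slack 0, so if it contains \<open>f\<close>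
      the new weight is 0 and its tightness survives.\<close>
    have "x = 0" if "f \<subseteq> U"
      using x_le[of U] x0 U that by (auto simp: tight_def slack_def \<U>_def)
    then show ?thesis using U sum_w' by (intro exI[of _ U]) (auto simp: tight_def)
  qed
  ultimately show ?case by blast
qed

text \<open>Uncrossing: the weight of induced edges is supermodular, while
  \<open>sparse_bound\<close> is modular in the cardinalities. Two common vertices make the bound
  applicable to the intersection, which leaves no slack for the union.\<close>

lemma tight_Un:
  assumes w: "sparse_weight a A F w" and fin: "finite F" "finite A"
    and T: "tight a A F w U" "tight a A F w U'" and c: "2 \<le> card (U \<inter> U')"
  shows "tight a A F w (U \<union> U')"
proof -
  have sub: "U \<subseteq> A" "U' \<subseteq> A" "finite U" "finite U'" using T fin(2)
    by (auto simp: tight_def intro: finite_subset)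
  have fi: "finite (induced F X)" for X using fin by (auto simp: induced_def)
  have card2: "card (U \<union> U') + card (U \<inter> U') = card U + card U'"
    using card_Un_Int[OF sub(3,4)] by simp
  have "2 \<le> card (U \<union> U')"
    using c sub by (meson Int_lower1 Un_upper1 card_mono finite_UnI order_trans)
  moreover have "sum w (induced F (U \<union> U')) \<le> sparse_bound a (card (U \<union> U'))"
    using w sub calculation by (auto simp: sparse_weight_def)
  moreover have "sum w (induced F (U \<inter> U')) \<le> sparse_bound a (card (U \<inter> U'))"
    using w sub c unfolding sparse_weight_def by blast
  moreover have "sum w (induced F U) + sum w (induced F U') \<le>
      sum w (induced F (U \<union> U')) + sum w (induced F (U \<inter> U'))"
  proof -
    have "induced F U \<inter> induced F U' = induced F (U \<inter> U')" by (auto simp: induced_def)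
    moreover have "sum w (induced F U \<union> induced F U') \<le> sum w (induced F (U \<union> U'))"
      using fi w by (intro sum_mono2) (auto simp: induced_def sparse_weight_def)
    ultimately show ?thesis using sum.union_inter[OF fi fi, of w U U'] by simp
  qed
  moreover have "sparse_bound a (card (U \<union> U')) + sparse_bound a (card (U \<inter> U')) =
      sparse_bound a (card U) + sparse_bound a (card U')"
  proof -
    have "real (card (U \<union> U')) + real (card (U \<inter> U')) = real (card U) + real (card U')"
      using card2 by linarith
    then have "a * (real (card (U \<union> U')) + real (card (U \<inter> U'))) = a * (real (card U) + real (card U'))"
      by simp
    then show ?thesis by (simp add: sparse_bound_def algebra_simps)
  qed
  ultimately show ?thesis using T sub by (auto simp: tight_def)
qed

text \<open>Distinct maximal tight sets meet in at most one vertex. If none of them contains \<open>e\<close>, then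
  the union of \<open>W\<close> with those meeting \<open>W\<close> in at least two vertices is tight after all.\<close>

lemma tight_clique_closure:
  assumes w: "sparse_weight a A F w" and fin: "finite F" "finite A" and F: "F \<subseteq> complete_graph A"
    and a: "a \<ge> 0" "sparse_bound a r = real (r choose 2) - 1"
      "\<And>s. 2 \<le> s \<Longrightarrow> s < r \<Longrightarrow> real (s choose 2) \<le> sparse_bound a s"
    and W: "W \<subseteq> A" "card W = r" "r \<ge> 2" and e: "e \<in> complete_graph W"
    and cov: "\<And>f. f \<in> complete_graph W - {e} \<Longrightarrow> \<exists>U. f \<subseteq> U \<and> tight a A F w U"
  shows "\<exists>U. e \<subseteq> U \<and> tight a A F w U"
proof (rule ccontr)
  assume none: "\<nexists>U. e \<subseteq> U \<and> tight a A F w U"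
  have finW: "finite W" using W fin finite_subset by blast
  define \<U> where "\<U> = {U. tight a A F w U \<and> 2 \<le> card (U \<inter> W) \<and>
      (\<forall>U'. tight a A F w U' \<longrightarrow> U \<subseteq> U' \<longrightarrow> U' = U)}"
  have sub: "U \<subseteq> A" "finite U" if "tight a A F w U" for U
    using that fin(2) by (auto simp: tight_def intro: finite_subset)
  have fi: "finite (induced F X)" for X using fin by (auto simp: induced_def)
  have fin\<U>: "finite \<U>"
    by (rule finite_subset[of _ "Pow A"]) (use sub fin in \<open>auto simp: \<U>_def\<close>)
  have fin_tight: "finite {U. tight a A F w U}"
    by (rule finite_subset[of _ "Pow A"]) (use sub fin in auto)
  have ex_max: "\<exists>U\<in>\<U>. f \<subseteq> U \<inter> W" if f: "f \<in> complete_graph W - {e}" for f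
  proof -
    obtain U0 where U0: "f \<subseteq> U0" "tight a A F w U0" using cov[OF f] by blast
    obtain U where U: "tight a A F w U" "U0 \<subseteq> U"
        "\<forall>U'. tight a A F w U' \<longrightarrow> U \<subseteq> U' \<longrightarrow> U' = U"
      using finite_has_maximal2[OF fin_tight, of U0] U0 by (metis mem_Collect_eq)
    have fW: "f \<subseteq> U \<inter> W" "card f = 2" using f U0 U by (auto simp: complete_graph_def)
    then have "2 \<le> card (U \<inter> W)" using finW by (metis card_mono finite_Int)
    with U fW show ?thesis by (auto simp: \<U>_def)
  qed
  have small_inter: "card (U \<inter> U') < 2" if "U \<in> \<U>" "U' \<in> \<U>" "U \<noteq> U'" for U U'
  proof (rule ccontr)
    assume "\<not> card (U \<inter> U') < 2"
    then have "tight a A F w (U \<union> U')" using that tight_Un[OF w fin, of U U'] by (auto simp: \<U>_def)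
    with that show False unfolding \<U>_def by blast
  qed
  have sW: "card (U \<inter> W) < r" if "U \<in> \<U>" for U
  proof (rule ccontr)
    assume "\<not> card (U \<inter> W) < r"
    then have "U \<inter> W = W" using finW W by (intro card_seteq) auto
    then have "e \<subseteq> U" using e by (auto simp: complete_graph_def)
    with that none show False by (auto simp: \<U>_def)
  qed
  \<comment> \<open>The covered pairs lie in traces \<open>U \<inter> W\<close> with fewer than
    \<open>r\<close> vertices, where even a full clique stays below \<open>sparse_bound\<close>.
    Hence the bounds of the traces already add up to at least \<open>sparse_bound a r\<close>;
    restoring the vertices outside \<open>W\<close>, at \<open>a\<close> each, turns traces into
    whole sets \<open>U\<close> and \<open>W\<close> into \<open>Z\<close>.\<close>
  have "real (r choose 2) - 1 = real (card (complete_graph W - {e}))"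
    using e finW W card_complete_graph[OF finW] by (simp add: of_nat_diff Suc_le_eq)
  also have "\<dots> \<le> real (card (\<Union>U\<in>\<U>. complete_graph (U \<inter> W)))"
  proof -
    have "complete_graph W - {e} \<subseteq> (\<Union>U\<in>\<U>. complete_graph (U \<inter> W))"
    proof
      fix f assume f: "f \<in> complete_graph W - {e}"
      from ex_max[OF f] obtain U where "U \<in> \<U>" "f \<subseteq> U \<inter> W" by blast
      with f show "f \<in> (\<Union>U\<in>\<U>. complete_graph (U \<inter> W))"
        by (intro UN_I[of U]) (auto simp: complete_graph_def)
    qed
    then show ?thesis using fin\<U> finW by (intro of_nat_mono card_mono) auto
  qed
  also have "\<dots> \<le> real (\<Sum>U\<in>\<U>. card (complete_graph (U \<inter> W)))"
    by (intro of_nat_mono card_UN_le fin\<U>)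
  also have "\<dots> = (\<Sum>U\<in>\<U>. real (card (U \<inter> W) choose 2))"
    using finW by (simp add: card_complete_graph)
  also have "\<dots> \<le> (\<Sum>U\<in>\<U>. sparse_bound a (card (U \<inter> W)))"
    using a(3) sW by (intro sum_mono) (auto simp: \<U>_def)
  finally have le1: "real (r choose 2) - 1 \<le> (\<Sum>U\<in>\<U>. sparse_bound a (card (U \<inter> W)))" .
  define Z where "Z = W \<union> \<Union>\<U>"
  have Z: "Z \<subseteq> A" "e \<subseteq> Z"
    using W sub e by (auto simp: Z_def \<U>_def complete_graph_def)
  then have "finite Z" using fin(2) finite_subset by blast
  have "2 \<le> card Z" using \<open>finite Z\<close> W by (metis Un_upper1 Z_def card_mono le_trans)
  have "Z = W \<union> (\<Union>U\<in>\<U>. U - W)" by (auto simp: Z_def)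
  then have "card Z \<le> card W + card (\<Union>U\<in>\<U>. U - W)" by (metis card_Un_le)
  also have "\<dots> \<le> r + (\<Sum>U\<in>\<U>. card (U - W))" using card_UN_le[OF fin\<U>, of "\<lambda>U. U - W"] W by linarith
  finally have cZ: "real (card Z) \<le> real r + (\<Sum>U\<in>\<U>. real (card (U - W)))"
    by (simp flip: of_nat_sum of_nat_add)
  have "sparse_bound a (card Z) \<le> sparse_bound a r + a * (\<Sum>U\<in>\<U>. real (card (U - W)))"
    using mult_left_mono[OF cZ a(1)] by (simp add: sparse_bound_def algebra_simps)
  also have "\<dots> \<le> (\<Sum>U\<in>\<U>. sparse_bound a (card (U \<inter> W))) + (\<Sum>U\<in>\<U>. a * real (card (U - W)))"
    using le1 a(2) by (simp add: sum_distrib_left)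
  also have "\<dots> = (\<Sum>U\<in>\<U>. sparse_bound a (card U))"
    unfolding sum.distrib[symmetric]
  proof (rule sum.cong)
    fix U assume "U \<in> \<U>"
    then have "finite U" using sub by (auto simp: \<U>_def)
    then have "card U = card (U \<inter> W) + card (U - W)"
      using card_Int_Diff by blast
    then show "sparse_bound a (card (U \<inter> W)) + a * real (card (U - W)) = sparse_bound a (card U)"
      by (simp add: sparse_bound_def algebra_simps)
  qed simp
  also have "\<dots> = (\<Sum>U\<in>\<U>. sum w (induced F U))"
    by (intro sum.cong) (auto simp: \<U>_def tight_def)
  \<comment> \<open>Two members of \<open>\<U>\<close> share at most one vertex and hence no edge,
    so no weight is counted twice.\<close>
  also have "\<dots> = sum w (\<Union>U\<in>\<U>. induced F U)"
  proof (rule sum.UNION_disjoint[symmetric])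
    show "\<forall>U\<in>\<U>. \<forall>U'\<in>\<U>. U \<noteq> U' \<longrightarrow> induced F U \<inter> induced F U' = {}"
    proof (intro ballI impI, rule ccontr)
      fix U U' assume UU: "U \<in> \<U>" "U' \<in> \<U>" "U \<noteq> U'" "induced F U \<inter> induced F U' \<noteq> {}"
      then obtain f where f: "f \<in> F" "f \<subseteq> U \<inter> U'" by (auto simp: induced_def)
      moreover have "finite (U \<inter> U')" using UU sub by (auto simp: \<U>_def)
      ultimately have "card f \<le> card (U \<inter> U')" by (simp add: card_mono)
      with f F small_inter[OF UU(1-3)] show False by (auto simp: complete_graph_def)
    qed
  qed (use fin\<U> fi in auto)
  also have "\<dots> \<le> sum w (induced F Z)"
    using fi w by (intro sum_mono2) (auto simp: induced_def sparse_weight_def Z_def)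
  finally have "sparse_bound a (card Z) \<le> sum w (induced F Z)" .
  moreover have "sum w (induced F Z) \<le> sparse_bound a (card Z)"
    using w Z \<open>2 \<le> card Z\<close> unfolding sparse_weight_def by blast
  ultimately have "tight a A F w Z"
    using Z \<open>2 \<le> card Z\<close> by (simp add: tight_def)
  with none Z show False by blast
qed

section \<open>Numerical properties of \<open>tau\<close> and of the critical slope\<close>

lemma real_choose_two: "real (n choose 2) = real n * (real n - 1) / 2"
  by (cases n) (auto simp: choose_two field_simps real_of_nat_div)

lemma tau_eq: "tau r = (real r - 2) * (real r + 1) / 2"
  by (simp add: tau_def real_choose_two field_simps)

lemma tau_ge_5: "r \<ge> 4 \<Longrightarrow> tau r \<ge> 5"
proof -
  assume "r \<ge> 4"
  then have "(real r - 2) * (real r + 1) \<ge> 2 * 5" by (intro mult_mono) auto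
  then show ?thesis by (simp add: tau_eq)
qed

definition slope :: "nat \<Rightarrow> real" where
  "slope r = (tau r - 1) / (real r - 2)"

lemma slope_ge_2: "r \<ge> 4 \<Longrightarrow> slope r \<ge> 2"
proof -
  assume r: "r \<ge> 4"
  then have "(real r - 4) * (real r - 1) \<ge> 0" by simp
  then show ?thesis using r by (simp add: slope_def tau_eq field_simps)
qed

lemma sparse_bound_slope:
  assumes "r \<ge> 4"
  shows "sparse_bound (slope r) r = tau r"
  using assms by (simp add: sparse_bound_def slope_def)

text \<open>Since \<open>s choose 2\<close> exceeds 1 by (s-2)(s+1)/2, it suffices that (s+1)/2 is
  at most the slope, which is at least r/2. Strictness of \<open>s < r\<close> matters: a full
  clique on \<open>r\<close> vertices exceeds the bound by one.\<close>

lemma choose_two_le_sparse_bound: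
  assumes "r \<ge> 4" "2 \<le> s" "s < r"
  shows "real (s choose 2) \<le> sparse_bound (slope r) s"
proof -
  have "real s + 1 \<le> real r" using assms by simp
  moreover have "real r / 2 \<le> slope r"
    using assms by (simp add: slope_def tau_eq field_simps)
  ultimately have "(real s + 1) / 2 \<le> slope r" by simp
  then have "(real s + 1) / 2 * (real s - 2) \<le> slope r * (real s - 2)"
    using assms by (intro mult_right_mono) auto
  then show ?thesis by (simp add: sparse_bound_def real_choose_two field_simps)
qed

text \<open>Tightness for a maximal sparse weight passes along the process by
  \<open>tight_clique_closure\<close>. Weights never exceed 1, because the bound for an edge taken
  as a two-vertex set is 1; so a tight set has at least as many edges as its weight.\<close>

lemma bootstrap_dense_subgraph:
  assumes r: "r \<ge> 4" and F: "F \<subseteq> K n" and f: "f \<in> bootstrap n r F s"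
  shows "\<exists>U\<subseteq>{1..n}. f \<subseteq> U \<and> sparse_bound (slope r) (card U) \<le> real (card (induced F U))"
proof -
  let ?a = "slope r" and ?A = "{1..n}"
  have a0: "?a \<ge> 0" using slope_ge_2[OF r] by simp
  have finF: "finite F" using F finite_subset finite_complete_graph by blast
  obtain w where w: "sparse_weight ?a ?A F w"
      "\<forall>f\<in>F. \<exists>U. f \<subseteq> U \<and> tight ?a ?A F w U"
    using exists_maximal_sparse_weight[OF finF F _ a0] by auto
  have "\<exists>U. f \<subseteq> U \<and> tight ?a ?A F w U"
    using f
  proof (induction s arbitrary: f)
    case 0
    then show ?case using w by simp
  next
    case (Suc s)
    show ?case using Suc.prems
    proof (cases rule: bootstrap_SucE)
      case 1
      then show ?thesis by (rule Suc.IH)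
    next
      case (2 W)
      show ?thesis
        by (rule tight_clique_closure[OF w(1) finF _ F a0 _ _ 2(1,2) _ 2(3)])
          (use r 2 Suc.IH sparse_bound_slope[OF r] choose_two_le_sparse_bound[OF r] in
            \<open>auto simp: tau_def\<close>)
    qed
  qed
  then obtain U where U: "f \<subseteq> U" "tight ?a ?A F w U" by blast
  have "w g \<le> 1" if g: "g \<in> F" for g
  proof -
    have g': "g \<subseteq> ?A" "card g = 2" using F g by (auto simp: complete_graph_def)
    have "induced F g = {g}"
    proof -
      have "h = g" if "h \<in> F" "h \<subseteq> g" for h
        using that g' F finite_subset[OF g'(1)]
        by (intro card_subset_eq) (auto simp: complete_graph_def)
      then show ?thesis using g by (auto simp: induced_def)
    qed
    moreover have "sum w (induced F g) \<le> sparse_bound ?a (card g)"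
      using w(1) g' unfolding sparse_weight_def by (metis order_refl)
    ultimately show ?thesis using g' by (simp add: sparse_bound_def)
  qed
  then have "sum w (induced F U) \<le> sum (\<lambda>_. 1) (induced F U)"
    by (intro sum_mono) (auto simp: induced_def)
  then show ?thesis using U by (auto simp: tight_def)
qed

subsection \<open>Witnesses\<close>

text \<open>Cliques chosen in different branches may share vertices and edges, so members can have
  fewer than tau^t edges. Allowing this makes the number of members a plain count of choices;
  members of the wrong size are filtered out later.\<close>

fun full_witnesses :: "nat \<Rightarrow> nat \<Rightarrow> nat \<Rightarrow> nat set \<Rightarrow> nat set set set" where
  "full_witnesses n r 0 e = {{e}}"
| "full_witnesses n r (Suc t) e =
    (\<Union>W\<in>{W. W \<subseteq> {1..n} \<and> card W = r \<and> e \<subseteq> W}.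
      (\<lambda>\<F>. \<Union>(\<F> ` (complete_graph W - {e}))) `
        (\<Pi>\<^sub>E f\<in>complete_graph W - {e}. full_witnesses n r t f))"

text \<open>The equality case drives the induction. A union of tau witnesses reaches tau^(t+1) edges
  only if each of them has tau^t, hence is full by induction. An edge present one step earlier
  already has a witness of at most tau^t edges, so it never meets the equality case.\<close>

lemma bootstrap_witness:
  assumes r: "r \<ge> 4" and G: "G \<subseteq> K n" and e: "e \<in> bootstrap n r G t"
  shows "\<exists>F\<subseteq>G. finite F \<and> e \<in> bootstrap n r F t \<and> card F \<le> ((r choose 2) - 1) ^ t \<and>
    (card F = ((r choose 2) - 1) ^ t \<longrightarrow> F \<in> full_witnesses n r t e)"
  using e
proof (induction t arbitrary: e)
  case 0
  then show ?case by (intro exI[of _ "{e}"]) auto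
next
  case (Suc t)
  let ?\<tau> = "(r choose 2) - 1"
  have tau: "real ?\<tau> = tau r"
    using r by (simp add: tau_def of_nat_diff Suc_le_eq)
  then have tau1: "?\<tau> > 1" using tau_ge_5[OF r] by linarith
  show ?case using Suc.prems
  proof (cases rule: bootstrap_SucE)
    case 1
    then obtain F where F: "F \<subseteq> G" "finite F" "e \<in> bootstrap n r F t" "card F \<le> ?\<tau> ^ t"
      using Suc.IH by blast
    moreover have "?\<tau> ^ t < ?\<tau> ^ Suc t" using tau1 by (intro power_strict_increasing) auto
    ultimately show ?thesis
      by (intro exI[of _ F]) (use monoD[OF mono_bootstrap, of t "Suc t" n r F] in \<open>auto simp del: power_Suc\<close>)
  next
    case (2 W)
    let ?I = "complete_graph W - {e}"
    have finW: "finite W" using 2 finite_subset by blast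
    then have finI: "finite ?I" by simp
    have cardI: "card ?I = ?\<tau>"
      using 2 finW card_complete_graph[OF finW] by simp
    obtain \<F> where \<F>: "\<And>f. f \<in> ?I \<Longrightarrow> \<F> f \<subseteq> G \<and> finite (\<F> f) \<and> f \<in> bootstrap n r (\<F> f) t \<and>
        card (\<F> f) \<le> ?\<tau> ^ t \<and> (card (\<F> f) = ?\<tau> ^ t \<longrightarrow> \<F> f \<in> full_witnesses n r t f)"
      using Suc.IH 2(5) by (metis subsetD)
    define F where "F = \<Union>(\<F> ` ?I)"
    have "e \<in> bootstrap n r F (Suc t)"
    proof (rule bootstrap_SucI[OF 2(1-3)], rule subsetI)
      fix f assume f: "f \<in> ?I"
      then have "\<F> f \<subseteq> F" by (auto simp: F_def)
      with \<F>[OF f] show "f \<in> bootstrap n r F t" using bootstrap_mono by blast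
    qed
    moreover have c1: "card F \<le> (\<Sum>f\<in>?I. card (\<F> f))"
      unfolding F_def by (rule card_UN_le[OF finI])
    have c2: "(\<Sum>f\<in>?I. card (\<F> f)) \<le> (\<Sum>f\<in>?I. ?\<tau> ^ t)"
      using \<F> by (intro sum_mono) auto
    moreover have "F \<in> full_witnesses n r (Suc t) e" if "card F = ?\<tau> ^ Suc t"
    proof -
      have eq: "(\<Sum>f\<in>?I. card (\<F> f)) = (\<Sum>f\<in>?I. ?\<tau> ^ t)"
        using c1 c2 that cardI by simp
      have "card (\<F> f) = ?\<tau> ^ t" if "f \<in> ?I" for f
      proof (rule ccontr)
        assume "card (\<F> f) \<noteq> ?\<tau> ^ t"
        then have "card (\<F> f) < ?\<tau> ^ t" using \<F>[OF that] by simp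
        then have "(\<Sum>f\<in>?I. card (\<F> f)) < (\<Sum>f\<in>?I. ?\<tau> ^ t)"
          using \<F> that by (intro sum_strict_mono_ex1 finI) auto
        with eq show False by simp
      qed
      then have full: "restrict \<F> ?I \<in> (\<Pi>\<^sub>E f\<in>?I. full_witnesses n r t f)"
        using \<F> by simp
      have "F = \<Union>((restrict \<F> ?I) ` ?I)" by (simp add: F_def)
      then have "F \<in> (\<lambda>\<F>. \<Union>(\<F> ` ?I)) ` (\<Pi>\<^sub>E f\<in>?I. full_witnesses n r t f)"
        using full by (rule image_eqI)
      moreover have "W \<in> {W. W \<subseteq> {1..n} \<and> card W = r \<and> e \<subseteq> W}"
        using 2 by (auto simp: complete_graph_def)
      ultimately show ?thesis unfolding full_witnesses.simps by (rule UN_I[rotated])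
    qed
    moreover have "F \<subseteq> G" "finite F" using \<F> finI by (auto simp: F_def)
    ultimately show ?thesis using cardI c1 by (intro exI[of _ F]) auto
  qed
qed

subsection \<open>The upper bound on the percolation probability\<close>

lemma prob_superset:
  assumes p: "0 \<le> p" "p \<le> 1" and F: "F \<subseteq> K n"
  shows "measure_pmf.prob (random_graph n p) {G. F \<subseteq> G} = p ^ card F"
proof -
  have "measure_pmf.prob (random_graph n p) {G. F \<subseteq> G} =
      measure_pmf.prob (Pi_pmf (K n) False (\<lambda>_. bernoulli_pmf p))
        (Pi (K n) (\<lambda>e. if e \<in> F then {True} else UNIV))"
    unfolding random_graph_def measure_map_pmf
    by (rule arg_cong[where f = "measure _"]) 
      (use F in \<open>auto simp: Pi_iff split: if_splits\<close>)
  also have "\<dots> = (\<Prod>e\<in>K n. measure_pmf.prob (bernoulli_pmf p) (if e \<in> F then {True} else UNIV))"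
    by (rule measure_Pi_pmf_Pi) simp
  also have "\<dots> = (\<Prod>e\<in>K n. if e \<in> F then p else 1)"
    using p by (intro prod.cong) (auto simp: measure_pmf_single)
  also have "\<dots> = p ^ card F"
    using F by (simp add: prod.If_cases Int_absorb1)
  finally show ?thesis .
qed

lemma set_pmf_random_graph: "G \<in> set_pmf (random_graph n p) \<Longrightarrow> G \<subseteq> K n"
  by (auto simp: random_graph_def)

section \<open>Counting complete unfoldings\<close>

lemma real_tau: "r \<ge> 4 \<Longrightarrow> real ((r choose 2) - 1) = tau r"
  by (simp add: tau_def of_nat_diff Suc_le_eq)

text \<open>This is v_t - 2 as a natural number: a complete unfolding has one clique for each path
  of length below \<open>t\<close>, and each clique adds r - 2 vertices.\<close>

definition new_vertices :: "nat \<Rightarrow> nat \<Rightarrow> nat" where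
  "new_vertices r t = (r - 2) * (\<Sum>i<t. ((r choose 2) - 1) ^ i)"

lemma new_vertices_Suc:
  "new_vertices r (Suc t) = (r - 2) + ((r choose 2) - 1) * new_vertices r t"
proof -
  have "a * (\<Sum>i<Suc t. b ^ i) = a + b * (a * (\<Sum>i<t. b ^ i))" for a b :: nat
    unfolding sum.lessThan_Suc_shift by (simp add: sum_distrib_left algebra_simps)
  then show ?thesis unfolding new_vertices_def .
qed

lemma new_vertices_eq:
  assumes "r \<ge> 4"
  shows "real (new_vertices r t) = (tau r ^ t - 1) / slope r"
proof -
  have "(\<Sum>i<t. tau r ^ i) = (tau r ^ t - 1) / (tau r - 1)"
    using tau_ge_5[OF assms] by (intro geometric_sum) simp
  then show ?thesis using assms real_tau[OF assms]
    by (simp add: new_vertices_def slope_def of_nat_diff)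
qed

lemma finite_full_witnesses: "finite (full_witnesses n r t e)"
proof (induction t arbitrary: e)
  case (Suc t)
  have "finite (complete_graph W - {e})" if "W \<subseteq> {1..n}" for W
    using finite_subset[OF that] by simp
  with Suc show ?case by (auto intro!: finite_PiE)
qed simp

lemma card_supersets_le:
  fixes V :: "'a set"
  assumes "finite V" "card e \<le> s" "finite e"
  shows "card {W. W \<subseteq> V \<and> card W = s \<and> e \<subseteq> W} \<le> card V ^ (s - card e)"
proof -
  have "card {W. W \<subseteq> V \<and> card W = s \<and> e \<subseteq> W} \<le> card {X. X \<subseteq> V \<and> card X = s - card e}"
  proof (rule card_inj_on_le)
    show "inj_on (\<lambda>W. W - e) {W. W \<subseteq> V \<and> card W = s \<and> e \<subseteq> W}"
      by (rule inj_onI) blast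
    show "(\<lambda>W. W - e) ` {W. W \<subseteq> V \<and> card W = s \<and> e \<subseteq> W} \<subseteq> {X. X \<subseteq> V \<and> card X = s - card e}"
      using assms(3) by (auto simp: card_Diff_subset)
  qed (use assms in auto)
  also have "\<dots> = card V choose (s - card e)" using assms by (simp add: n_subsets)
  also have "\<dots> \<le> card V ^ (s - card e)"
    by (cases "s - card e \<le> card V") (auto intro: binomial_le_pow simp: binomial_eq_0)
  finally show ?thesis .
qed

text \<open>There are at most n^(r-2) cliques on the root edge, and one witness is chosen for each
  of their tau other edges; the exponents obey \<open>new_vertices_Suc\<close>.\<close>

lemma card_full_witnesses_le:
  assumes "r \<ge> 4" "card e = 2"
  shows "card (full_witnesses n r t e) \<le> n ^ new_vertices r t"
  using assms(2)
proof (induction t arbitrary: e)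
  case 0
  then show ?case by (simp add: new_vertices_def)
next
  case (Suc t)
  let ?\<W> = "{W. W \<subseteq> {1..n} \<and> card W = r \<and> e \<subseteq> W}"
  have fin: "finite ?\<W>" by simp
  have "card (full_witnesses n r (Suc t) e) \<le>
      (\<Sum>W\<in>?\<W>. card ((\<lambda>\<F>. \<Union>(\<F> ` (complete_graph W - {e}))) `
        (\<Pi>\<^sub>E f\<in>complete_graph W - {e}. full_witnesses n r t f)))"
    unfolding full_witnesses.simps by (rule card_UN_le[OF fin])
  also have "\<dots> \<le> (\<Sum>W\<in>?\<W>. n ^ (((r choose 2) - 1) * new_vertices r t))"
  proof (rule sum_mono)
    fix W assume W: "W \<in> ?\<W>"
    then have finW: "finite W" using finite_subset by blast
    let ?I = "complete_graph W - {e}"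
    have finI: "finite ?I" using finW by simp
    have cI: "card ?I = (r choose 2) - 1"
      using W finW Suc.prems card_complete_graph[OF finW]
      by (subst card_Diff_singleton) (auto simp: complete_graph_def)
    have "card ((\<lambda>\<F>. \<Union>(\<F> ` ?I)) ` (\<Pi>\<^sub>E f\<in>?I. full_witnesses n r t f)) \<le>
        card (\<Pi>\<^sub>E f\<in>?I. full_witnesses n r t f)"
      using finI finite_full_witnesses by (intro card_image_le finite_PiE)
    also have "\<dots> = (\<Prod>f\<in>?I. card (full_witnesses n r t f))" by (rule card_PiE[OF finI])
    also have "\<dots> \<le> (\<Prod>f\<in>?I. n ^ new_vertices r t)"
      using Suc.IH by (intro prod_mono) (auto simp: complete_graph_def)
    also have "\<dots> = n ^ (((r choose 2) - 1) * new_vertices r t)"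
      using cI by (simp add: power_mult mult.commute)
    finally show "card ((\<lambda>\<F>. \<Union>(\<F> ` ?I)) ` (\<Pi>\<^sub>E f\<in>?I. full_witnesses n r t f)) \<le>
        n ^ (((r choose 2) - 1) * new_vertices r t)" .
  qed
  also have "\<dots> = card ?\<W> * n ^ (((r choose 2) - 1) * new_vertices r t)" by simp
  also have "card ?\<W> \<le> n ^ (r - 2)"
    using card_supersets_le[of "{1..n}" e r] assms(1) Suc.prems card_ge_0_finite[of e] by simp
  finally show ?case by (simp add: new_vertices_Suc power_add)
qed

section \<open>Dense spots and the first moment bound\<close>

lemma card_small_subsets_le:
  assumes "finite A" "card A \<le> b" "2 \<le> b"
  shows "card {P. P \<subseteq> A \<and> card P < m} \<le> b ^ m"
proof -
  have "{P. P \<subseteq> A \<and> card P < m} = (\<Union>k<m. {P. P \<subseteq> A \<and> card P = k})" by auto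
  then have "card {P. P \<subseteq> A \<and> card P < m} \<le> (\<Sum>k<m. card {P. P \<subseteq> A \<and> card P = k})"
    using card_UN_le[of "{..<m}" "\<lambda>k. {P. P \<subseteq> A \<and> card P = k}"] by simp
  also have "\<dots> \<le> (\<Sum>k<m. b ^ k)"
  proof (rule sum_mono)
    fix k
    have "card {P. P \<subseteq> A \<and> card P = k} = card A choose k" using assms by (simp add: n_subsets)
    also have "\<dots> \<le> card A ^ k"
      by (cases "k \<le> card A") (auto intro: binomial_le_pow simp: binomial_eq_0)
    also have "\<dots> \<le> b ^ k" using assms by (simp add: power_mono)
    finally show "card {P. P \<subseteq> A \<and> card P = k} \<le> b ^ k" .
  qed
  also have "\<dots> \<le> b ^ m"
  proof (induction m)
    case (Suc m)
    have "(\<Sum>k<Suc m. b ^ k) \<le> b ^ m + b ^ m" using Suc by simp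
    also have "\<dots> = 2 * b ^ m" by simp
    also have "\<dots> \<le> b * b ^ m" using assms(3) by (intro mult_right_mono) auto
    finally show ?case by simp
  qed simp
  finally show ?thesis .
qed

text \<open>\<open>P\<close> stands for the part of a non-full witness inside \<open>U\<close>, not
  for all edges present there. This is why fewer than \<open>m\<close> edges may be demanded, the
  condition that later yields the polynomial gain.\<close>

definition dense_pairs :: "nat \<Rightarrow> nat \<Rightarrow> nat \<Rightarrow> nat set \<Rightarrow> (nat set \<times> nat set set) set" where
  "dense_pairs n r m e = {(U, P). U \<subseteq> {1..n} \<and> e \<subseteq> U \<and> P \<subseteq> complete_graph U \<and> card P < m \<and>
     sparse_bound (slope r) (card U) \<le> real (card P)}"

lemma dense_pairs_subset_K: "(U, P) \<in> dense_pairs n r m e \<Longrightarrow> P \<subseteq> K n"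
  unfolding dense_pairs_def using complete_graph_mono[of U "{1..n}"] by blast

lemma finite_dense_pairs: "finite (dense_pairs n r m e)"
proof (rule finite_subset)
  show "dense_pairs n r m e \<subseteq> Pow {1..n} \<times> Pow (K n)"
    using dense_pairs_subset_K unfolding dense_pairs_def by blast
qed simp

text \<open>A union bound over the two kinds of witness \<open>F\<close>: with exactly
  \<open>m\<close> edges it is a full witness, and with fewer its edges inside the vertex set given
  by \<open>bootstrap_dense_subgraph\<close> form a dense pair.\<close>

lemma prob_edge_le_sums:
  fixes r n t :: nat and p :: real and e :: "nat set"
  assumes r: "r \<ge> 4" and p: "0 \<le> p" "p \<le> 1"
  defines "m \<equiv> ((r choose 2) - 1) ^ t"
  shows "measure_pmf.prob (random_graph n p) {G. e \<in> bootstrap n r G t} \<le>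
    real (card (full_witnesses n r t e)) * p ^ m + (\<Sum>(U, P)\<in>dense_pairs n r m e. p ^ card P)"
proof -
  let ?M = "random_graph n p"
  define \<A> where "\<A> = {F \<in> full_witnesses n r t e. card F = m \<and> F \<subseteq> K n}"
  let ?A = "\<Union>F\<in>\<A>. {G. F \<subseteq> G}"
  let ?B = "\<Union>(U,P)\<in>dense_pairs n r m e. {G. P \<subseteq> G}"
  have fin\<A>: "finite \<A>" by (simp add: \<A>_def finite_full_witnesses)
  have incl: "G \<in> ?A \<union> ?B" if G: "G \<subseteq> K n" "e \<in> bootstrap n r G t" for G
  proof -
    obtain F where F: "F \<subseteq> G" "finite F" "e \<in> bootstrap n r F t" "card F \<le> m"
        "card F = m \<Longrightarrow> F \<in> full_witnesses n r t e"
      using bootstrap_witness[OF r G] unfolding m_def by blast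
    show ?thesis
    proof (cases "card F = m")
      case True
      then have "F \<in> \<A>" using F G by (auto simp: \<A>_def)
      then show ?thesis using F by auto
    next
      case False
      have "F \<subseteq> K n" using F G by blast
      then obtain U where U: "U \<subseteq> {1..n}" "e \<subseteq> U"
          "sparse_bound (slope r) (card U) \<le> real (card (induced F U))"
        using bootstrap_dense_subgraph[OF r _ F(3)] by blast
      have "induced F U \<subseteq> complete_graph U" "induced F U \<subseteq> F"
        using \<open>F \<subseteq> K n\<close> by (auto simp: induced_def complete_graph_def)
      moreover have "card (induced F U) < m"
        using False F card_mono[OF F(2) \<open>induced F U \<subseteq> F\<close>] by linarith
      ultimately have "(U, induced F U) \<in> dense_pairs n r m e"
        using U by (auto simp: dense_pairs_def)
      with \<open>induced F U \<subseteq> F\<close> F(1) show ?thesis by blast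
    qed
  qed
  have "measure_pmf.prob ?M {G. e \<in> bootstrap n r G t} \<le> measure_pmf.prob ?M (?A \<union> ?B)"
    by (rule measure_pmf.finite_measure_mono_AE)
      (use incl set_pmf_random_graph in \<open>auto simp: AE_measure_pmf_iff\<close>)
  also have "\<dots> \<le> measure_pmf.prob ?M ?A + measure_pmf.prob ?M ?B"
    by (rule measure_Un_le) auto
  also have "measure_pmf.prob ?M ?A \<le> (\<Sum>F\<in>\<A>. measure_pmf.prob ?M {G. F \<subseteq> G})"
    by (rule measure_UNION_le[OF fin\<A>]) auto
  also have "\<dots> = (\<Sum>F\<in>\<A>. p ^ m)"
    by (intro sum.cong) (auto simp: \<A>_def prob_superset[OF p])
  also have "\<dots> \<le> real (card (full_witnesses n r t e)) * p ^ m"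
    using p finite_full_witnesses by (auto simp: \<A>_def intro!: mult_right_mono card_mono)
  also have "measure_pmf.prob ?M ?B \<le>
      (\<Sum>UP\<in>dense_pairs n r m e. measure_pmf.prob ?M (case UP of (U, P) \<Rightarrow> {G. P \<subseteq> G}))"
    by (rule measure_UNION_le[OF finite_dense_pairs]) auto
  also have "\<dots> = (\<Sum>(U, P)\<in>dense_pairs n r m e. p ^ card P)"
    by (intro sum.cong) (auto intro!: prob_superset[OF p] dense_pairs_subset_K)
  finally show ?thesis by simp
qed

text \<open>For each size u in 2..m, the at most n^(u-2) choices of \<open>U\<close> cancel against
  the probability up to n^(-1/(slope m)). For fixed \<open>U\<close> there are at most (m^2)^m
  choices of \<open>P\<close>, being fewer than \<open>m\<close> out of at most m^2 pairs.\<close>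

lemma sum_dense_pairs_le:
  assumes r: "r \<ge> 4" and n: "n \<ge> 1" and p: "0 \<le> p" and m: "m \<ge> 2" and e: "card e = 2"
    and p_le: "p \<le> real n powr (- ((1 - 1 / real m) / slope r))"
  shows "(\<Sum>(U, P)\<in>dense_pairs n r m e. p ^ card P) \<le>
    real m * real (m ^ (2 * m)) * real n powr (- (1 / (slope r * real m)))"
proof -
  let ?c = "real n powr (- (1 / (slope r * real m)))"
  have s2: "slope r \<ge> 2" by (rule slope_ge_2[OF r])
  have fe: "finite e" using e card_ge_0_finite by force
  define \<U> where "\<U> u = {U. U \<subseteq> {1..n} \<and> card U = u \<and> e \<subseteq> U}" for u
  define \<P> where "\<P> U = {P. P \<subseteq> complete_graph U \<and> card P < m}" for U :: "nat set"
  have fin\<U>: "finite (\<U> u)" for u by (simp add: \<U>_def)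
  have finU: "finite U" if "U \<in> \<U> u" for U u
    using that finite_subset by (auto simp: \<U>_def)
  have fin\<P>: "finite (\<P> U)" if "U \<in> \<U> u" for U u
    using finU[OF that] by (simp add: \<P>_def)
  have sub: "dense_pairs n r m e \<subseteq> (\<Union>u\<in>{2..m}. \<Union>U\<in>\<U> u. Pair U ` \<P> U)"
  proof safe
    fix U P assume UP: "(U, P) \<in> dense_pairs n r m e"
    then have U: "U \<subseteq> {1..n}" "e \<subseteq> U" "P \<in> \<P> U" "card P < m"
        "sparse_bound (slope r) (card U) \<le> real (card P)"
      by (auto simp: dense_pairs_def \<P>_def)
    have "finite U" using U finite_subset by blast
    then have u2: "2 \<le> card U" using e U by (metis card_mono)
    \<comment> \<open>A slope of at least 1 forces an edge for each vertex beyond two, so having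
      fewer than \<open>m\<close> edges bounds the size of \<open>U\<close>.\<close>
    have "1 * (real (card U) - 2) \<le> slope r * (real (card U) - 2)"
      using s2 u2 by (intro mult_right_mono) auto
    then have "card U \<le> m" using U by (simp add: sparse_bound_def)
    with u2 U show "(U, P) \<in> (\<Union>u\<in>{2..m}. \<Union>U\<in>\<U> u. Pair U ` \<P> U)"
      by (intro UN_I[of "card U"] UN_I[of U] image_eqI[of _ _ P]) (auto simp: \<U>_def)
  qed
  have term_le: "p ^ card P \<le> real n powr (- (real (card U) - 2)) * ?c"
    if "(U, P) \<in> dense_pairs n r m e" for U P
  proof -
    have k: "card P < m" "sparse_bound (slope r) (card U) \<le> real (card P)"
      using that by (auto simp: dense_pairs_def)
    have "p ^ card P \<le> (real n powr (- ((1 - 1 / real m) / slope r))) ^ card P"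
      using p p_le by (intro power_mono)
    also have "\<dots> = real n powr (- ((1 - 1 / real m) / slope r) * real (card P))"
      using n by (subst powr_power) (auto simp: mult.commute)
    also have "\<dots> \<le> real n powr (- (real (card U) - 2) - 1 / (slope r * real m))"
    proof (rule powr_mono)
      \<comment> \<open>With k = \<open>card P\<close> and a = \<open>slope r\<close>, k <= m-1
        gives k/m <= 1 - 1/m, and density gives k >= a(u-2) + 1. Hence (1-1/m)k >= a(u-2) + 1/m; the
        final 1/m is the whole gain.\<close>
      have "real (card P) + 1 \<le> real m" using k by linarith
      then have "slope r * (real (card U) - 2) \<le> real (card P) - 1" "real (card P) / real m \<le> 1 - 1 / real m"
        using k m by (auto simp: sparse_bound_def field_simps)
      then have "slope r * (real (card U) - 2) + 1 / real m \<le> (1 - 1 / real m) * real (card P)"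
        by (simp add: algebra_simps)
      then have "(slope r * (real (card U) - 2) + 1 / real m) / slope r \<le> (1 - 1 / real m) * real (card P) / slope r"
        using s2 by (intro divide_right_mono) auto
      moreover have "(slope r * (real (card U) - 2) + 1 / real m) / slope r = (real (card U) - 2) + 1 / (slope r * real m)"
        using s2 m by (simp add: field_simps)
      ultimately show "- ((1 - 1 / real m) / slope r) * real (card P) \<le> - (real (card U) - 2) - 1 / (slope r * real m)"
        by simp
    qed (use n in auto)
    also have "\<dots> = real n powr (- (real (card U) - 2)) * ?c"
      by (simp add: powr_add[symmetric])
    finally show ?thesis .
  qed
  have "(\<Sum>(U, P)\<in>dense_pairs n r m e. p ^ card P) \<le>
      (\<Sum>(U, P)\<in>dense_pairs n r m e. real n powr (- (real (card U) - 2)) * ?c)"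
    using term_le by (intro sum_mono) auto
  also have "\<dots> \<le> (\<Sum>(U, P)\<in>(\<Union>u\<in>{2..m}. \<Union>U\<in>\<U> u. Pair U ` \<P> U). real n powr (- (real (card U) - 2)) * ?c)"
    using fin\<U> fin\<P> by (intro sum_mono2 sub) auto
  also have "\<dots> = (\<Sum>u\<in>{2..m}. \<Sum>U\<in>\<U> u. \<Sum>P\<in>\<P> U. real n powr (- (real (card U) - 2)) * ?c)"
    using fin\<U> fin\<P>
    by (subst sum.UNION_disjoint; (subst sum.UNION_disjoint)?)
      (auto simp: \<U>_def sum.reindex inj_on_def intro!: sum.cong)
  also have "\<dots> \<le> (\<Sum>u\<in>{2..m}. real (m ^ (2 * m)) * ?c)"
  proof (rule sum_mono)
    fix u assume u: "u \<in> {2..m}"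
    have "(\<Sum>U\<in>\<U> u. \<Sum>P\<in>\<P> U. real n powr (- (real (card U) - 2)) * ?c) \<le>
        (\<Sum>U\<in>\<U> u. real (m ^ (2 * m)) * (real n powr (- (real u - 2)) * ?c))"
    proof (rule sum_mono)
      fix U assume U: "U \<in> \<U> u"
      have cu: "card U = u" using U by (simp add: \<U>_def)
      have "card (complete_graph U) \<le> m ^ 2"
      proof -
        have "card (complete_graph U) = u choose 2"
          using finU[OF U] cu by (simp add: card_complete_graph)
        also have "\<dots> \<le> u ^ 2" using u by (intro binomial_le_pow) auto
        also have "\<dots> \<le> m ^ 2" using u by (intro power_mono) auto
        finally show ?thesis .
      qed
      moreover have "2 \<le> m ^ 2" using power_mono[OF m, of 2] by simp
      ultimately have "card (\<P> U) \<le> (m ^ 2) ^ m"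
        unfolding \<P>_def using finU[OF U] by (intro card_small_subsets_le) auto
      then have "real (card (\<P> U)) \<le> real (m ^ (2 * m))" by (simp only: power_mult of_nat_le_iff)
      then show "(\<Sum>P\<in>\<P> U. real n powr (- (real (card U) - 2)) * ?c) \<le>
          real (m ^ (2 * m)) * (real n powr (- (real u - 2)) * ?c)"
        unfolding sum_constant cu by (intro mult_right_mono) auto
    qed
    also have "\<dots> = real (card (\<U> u)) * (real n powr (- (real u - 2))) * (real (m ^ (2 * m)) * ?c)"
      by simp
    also have "\<dots> \<le> 1 * (real (m ^ (2 * m)) * ?c)"
    proof (rule mult_right_mono)
      have "card (\<U> u) \<le> n ^ (u - 2)"
        using card_supersets_le[of "{1..n}" e u] u e fe by (simp add: \<U>_def)
      then have "real (card (\<U> u)) \<le> real (n ^ (u - 2))" by linarith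
      also have "\<dots> = real n powr (real u - 2)"
        using n u by (simp add: powr_realpow[symmetric] of_nat_diff)
      finally have "real (card (\<U> u)) * real n powr (- (real u - 2)) \<le>
          real n powr (real u - 2) * real n powr (- (real u - 2))"
        by (rule mult_right_mono) simp
      also have "\<dots> = 1" using n by (simp add: powr_add[symmetric])
      finally show "real (card (\<U> u)) * real n powr (- (real u - 2)) \<le> 1" .
    qed simp
    finally show "(\<Sum>U\<in>\<U> u. \<Sum>P\<in>\<P> U. real n powr (- (real (card U) - 2)) * ?c) \<le>
        real (m ^ (2 * m)) * ?c" by simp
  qed
  also have "\<dots> \<le> real m * (real (m ^ (2 * m)) * ?c)"
    unfolding sum_constant by (intro mult_right_mono) auto
  finally show ?thesis by (simp add: mult.assoc)
qed

text \<open>Percolation requires the single edge {1, 2}, which suffices here. Full witnesses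
  contribute at most n^(v_t-2) p^m <= w^(-m) <= 1/w: all powers of n cancel and only
  \<open>w\<close> is gained.\<close>

lemma prob_percolation_le:
  fixes r n t :: nat and p w :: real
  assumes r: "r \<ge> 4" and n: "n \<ge> 2" and p: "0 \<le> p" "p \<le> 1" and t: "t \<ge> 1" and w: "w \<ge> 1"
  defines "m \<equiv> ((r choose 2) - 1) ^ t"
  assumes p_le: "p \<le> real n powr (- ((1 - 1 / real m) / slope r)) / w"
  shows "measure_pmf.prob (random_graph n p) {G. percolation_time n r G \<le> enat t} \<le>
    1 / w + real m * real (m ^ (2 * m)) * real n powr (- (1 / (slope r * real m)))"
proof -
  have tau: "(r choose 2) - 1 \<ge> 5"
    using real_tau[OF r] tau_ge_5[OF r] by linarith
  have m2: "m \<ge> 2"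
    using self_le_power[of "(r choose 2) - 1" t] tau t by (simp add: m_def)
  have m_real: "real m = tau r ^ t" using real_tau[OF r] by (simp add: m_def)
  let ?e = "{1, 2::nat}" and ?q = "real n powr (- ((1 - 1 / real m) / slope r))"
  have e: "?e \<in> K n" "card ?e = 2" using n by (auto simp: complete_graph_def)
  have "measure_pmf.prob (random_graph n p) {G. percolation_time n r G \<le> enat t} \<le>
      measure_pmf.prob (random_graph n p) {G. ?e \<in> bootstrap n r G t}"
    by (rule measure_pmf.finite_measure_mono_AE)
      (use e set_pmf_random_graph percolation_time_le_iff in \<open>auto simp: AE_measure_pmf_iff\<close>)
  also have "\<dots> \<le> real (card (full_witnesses n r t ?e)) * p ^ m +
      (\<Sum>(U, P)\<in>dense_pairs n r m ?e. p ^ card P)"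
    unfolding m_def by (rule prob_edge_le_sums[OF r p])
  also have "real (card (full_witnesses n r t ?e)) * p ^ m \<le> 1 / w"
  proof -
    have "real (card (full_witnesses n r t ?e)) \<le> real (n ^ new_vertices r t)"
      using card_full_witnesses_le[OF r e(2), of n t] by linarith
    also have "\<dots> = real n powr ((real m - 1) / slope r)"
      using n new_vertices_eq[OF r, of t] m_real by (simp add: powr_realpow[symmetric])
    finally have 1: "real (card (full_witnesses n r t ?e)) \<le> real n powr ((real m - 1) / slope r)" .
    have "p ^ m \<le> (?q / w) ^ m" using p p_le by (intro power_mono)
    also have "\<dots> = ?q ^ m / w ^ m" by (simp add: power_divide)
    also have "?q ^ m = real n powr (- ((real m - 1) / slope r))"
    proof -
      have "real m * - ((1 - 1 / real m) / slope r) = - ((real m - 1) / slope r)"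
        using m2 slope_ge_2[OF r] by (simp add: field_simps)
      then show ?thesis using n powr_power[of "real n" "- ((1 - 1 / real m) / slope r)" m]
        by (metis of_nat_0_eq_iff not_numeral_le_zero)
    qed
    also have "real n powr (- ((real m - 1) / slope r)) / w ^ m \<le>
        real n powr (- ((real m - 1) / slope r)) / w"
      using w m2 self_le_power[of w m] by (intro divide_left_mono) auto
    finally have 2: "p ^ m \<le> real n powr (- ((real m - 1) / slope r)) / w" .
    have "real (card (full_witnesses n r t ?e)) * p ^ m \<le>
        real n powr ((real m - 1) / slope r) * (real n powr (- ((real m - 1) / slope r)) / w)"
      using 1 2 p by (intro mult_mono) auto
    also have "\<dots> = 1 / w" using n by (simp add: powr_add[symmetric])
    finally show ?thesis .
  qed
  also have "(\<Sum>(U, P)\<in>dense_pairs n r m ?e. p ^ card P) \<le>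
      real m * real (m ^ (2 * m)) * real n powr (- (1 / (slope r * real m)))"
  proof (rule sum_dense_pairs_le[OF r _ p(1) m2 e(2)])
    have "?q / w \<le> ?q / 1" using w by (intro divide_left_mono) auto
    then show "p \<le> ?q" using p_le by simp
  qed (use n in simp)
  finally show ?thesis by simp
qed

subsection \<open>The unfolding tree\<close>

type_synonym tree_vertex = "(nat \<times> nat) list \<times> nat"

text \<open>A clique is unfolded at the root edge with ends 0 and 1, and recursively at each of its other
  edges. The vertex \<open>(q, i)\<close> with \<open>i \<ge> 2\<close> is the \<open>i\<close>-th vertex of the clique placed on the edge
  reached along \<open>q\<close>, outermost edge first.\<close>

definition gadget_edges :: "nat \<Rightarrow> (nat \<times> nat) set" where
  "gadget_edges r = {(a, b). a < b \<and> b < r \<and> (a, b) \<noteq> (0, 1)}"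

definition roots :: "tree_vertex set" where
  "roots = {([], 0), ([], 1)}"

text \<open>Glues a smaller tree onto the clique edge \<open>f\<close>. Its roots become the ends of
  \<open>f\<close>, which are vertices of the top clique and keep the empty path; every other vertex
  gets \<open>f\<close> as a new first step.\<close>

definition lift_vertex :: "nat \<times> nat \<Rightarrow> tree_vertex \<Rightarrow> tree_vertex" where
  "lift_vertex f v = (if v = ([], 0) then ([], fst f) else if v = ([], 1) then ([], snd f)
     else (f # fst v, snd v))"

fun tree_edge :: "(nat \<times> nat) list \<Rightarrow> tree_vertex set" where
  "tree_edge [] = roots"
| "tree_edge (f # q) = lift_vertex f ` tree_edge q"

definition paths :: "nat \<Rightarrow> nat \<Rightarrow> (nat \<times> nat) list set" where
  "paths r t = {q. set q \<subseteq> gadget_edges r \<and> length q = t}"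

definition inner_vertices :: "nat \<Rightarrow> nat \<Rightarrow> tree_vertex set" where
  "inner_vertices r t = {(q, i). set q \<subseteq> gadget_edges r \<and> length q < t \<and> 2 \<le> i \<and> i < r}"

lemma finite_gadget_edges [simp]: "finite (gadget_edges r)"
  by (rule finite_subset[of _ "{..<r} \<times> {..<r}"]) (auto simp: gadget_edges_def)

lemma card_ordered_pairs_le:
  fixes S :: "'a :: linorder set"
  assumes "finite S" "R \<subseteq> {(a, b). a < b \<and> a \<in> S \<and> b \<in> S}"
  shows "card R \<le> card S choose 2"
proof -
  have "card R \<le> card (complete_graph S)"
  proof (rule card_inj_on_le)
    show "inj_on (\<lambda>(a, b). {a, b}) R"
    proof (rule inj_onI)
      fix x y assume "x \<in> R" "y \<in> R" and eq: "(case x of (a, b) \<Rightarrow> {a, b}) = (case y of (a, b) \<Rightarrow> {a, b})"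
      then have "fst x < snd x" "fst y < snd y" using assms(2) by auto
      with eq show "x = y" by (auto simp: doubleton_eq_iff split_beta prod_eq_iff)
    qed
    show "(\<lambda>(a, b). {a, b}) ` R \<subseteq> complete_graph S"
      using assms(2) by (fastforce simp: complete_graph_def)
  qed (use assms(1) in simp)
  then show ?thesis using assms(1) by (simp add: card_complete_graph)
qed

lemma gadget_edge_exists:
  assumes "e \<subseteq> {..<r}" "card e = 2" "e \<noteq> {0, 1}"
  shows "\<exists>(a, b)\<in>gadget_edges r. e = {a, b}"
proof -
  obtain x y where xy: "e = {x, y}" "x \<noteq> y" using assms(2) by (auto simp: card_2_iff)
  then have "(min x y, max x y) \<in> gadget_edges r" "e = {min x y, max x y}"
    using assms by (auto simp: gadget_edges_def min_def max_def)
  then show ?thesis by blast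
qed

lemma card_gadget_edges:
  assumes "r \<ge> 4"
  shows "card (gadget_edges r) = (r choose 2) - 1"
proof -
  have "bij_betw (\<lambda>(a, b). {a, b}) (gadget_edges r) (complete_graph {..<r} - {{0, 1}})"
    unfolding bij_betw_def
  proof
    show "inj_on (\<lambda>(a, b). {a, b}) (gadget_edges r)"
      by (rule inj_onI) (fastforce simp: doubleton_eq_iff gadget_edges_def)
    show "(\<lambda>(a, b). {a, b}) ` gadget_edges r = complete_graph {..<r} - {{0, 1}}"
    proof
      show "(\<lambda>(a, b). {a, b}) ` gadget_edges r \<subseteq> complete_graph {..<r} - {{0, 1}}"
      proof
        fix e assume "e \<in> (\<lambda>(a, b). {a, b}) ` gadget_edges r"
        then obtain a b where "e = {a, b}" "a < b" "b < r" "(a, b) \<noteq> (0, 1)"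
          by (auto simp: gadget_edges_def)
        then show "e \<in> complete_graph {..<r} - {{0, 1}}"
          by (simp add: complete_graph_def doubleton_eq_iff)
      qed
      show "complete_graph {..<r} - {{0, 1}} \<subseteq> (\<lambda>(a, b). {a, b}) ` gadget_edges r"
      proof
        fix e assume "e \<in> complete_graph {..<r} - {{0, 1}}"
        then have "\<exists>(a, b)\<in>gadget_edges r. e = {a, b}"
          by (intro gadget_edge_exists) (auto simp: complete_graph_def)
        then show "e \<in> (\<lambda>(a, b). {a, b}) ` gadget_edges r" by force
      qed
    qed
  qed
  then have "card (gadget_edges r) = card (complete_graph {..<r} - {{0, 1}})"
    by (rule bij_betw_same_card)
  also have "\<dots> = (r choose 2) - 1"
    using assms by (subst card_Diff_singleton) (auto simp: complete_graph_def n_subsets)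
  finally show ?thesis .
qed

lemma finite_paths [simp]: "finite (paths r t)"
  unfolding paths_def by (rule finite_lists_length_eq) simp

lemma card_paths: "r \<ge> 4 \<Longrightarrow> card (paths r t) = ((r choose 2) - 1) ^ t"
  unfolding paths_def by (simp add: card_lists_length_eq card_gadget_edges)

lemma inner_vertices_eq: "inner_vertices r t = (\<Union>s<t. paths r s) \<times> {2..<r}"
  by (auto simp: inner_vertices_def paths_def)

lemma finite_inner_vertices [simp]: "finite (inner_vertices r t)"
  unfolding inner_vertices_eq by auto

lemma card_inner_vertices:
  assumes "r \<ge> 4"
  shows "card (inner_vertices r t) = new_vertices r t"
proof -
  have "card (\<Union>s<t. paths r s) = (\<Sum>s<t. card (paths r s))"
    by (rule card_UN_disjoint) (simp_all, auto simp: paths_def)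
  then show ?thesis
    by (simp add: inner_vertices_eq new_vertices_def card_cartesian_product card_paths[OF assms])
qed

lemma roots_disjoint_inner: "roots \<inter> inner_vertices r t = {}"
  by (auto simp: roots_def inner_vertices_def)

lemma lift_vertex_simps [simp]:
  "lift_vertex f ([], 0) = ([], fst f)" "lift_vertex f ([], Suc 0) = ([], snd f)"
  "v \<notin> roots \<Longrightarrow> lift_vertex f v = (f # fst v, snd v)"
  by (auto simp: lift_vertex_def roots_def)

lemma inj_lift_vertex: "fst f \<noteq> snd f \<Longrightarrow> inj (lift_vertex f)"
  by (rule injI) (auto simp: lift_vertex_def prod_eq_iff split: if_splits)

lemma lift_vertex_in:
  assumes "f \<in> gadget_edges r" "v \<in> inner_vertices r t \<union> roots"
  shows "lift_vertex f v \<in> inner_vertices r (Suc t) \<union> roots"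
  using assms
  by (auto simp: lift_vertex_def inner_vertices_def roots_def gadget_edges_def)

lemma tree_edge_subset: "q \<in> paths r t \<Longrightarrow> tree_edge q \<subseteq> inner_vertices r t \<union> roots"
proof (induction q arbitrary: t)
  case (Cons f q)
  then obtain s where s: "t = Suc s" "q \<in> paths r s" "f \<in> gadget_edges r"
    by (auto simp: paths_def)
  show ?case
    unfolding tree_edge.simps s(1) using Cons.IH[OF s(2)] lift_vertex_in[OF s(3), of _ s] by blast
qed auto

lemma card_tree_edge: "set q \<subseteq> gadget_edges r \<Longrightarrow> card (tree_edge q) = 2"
proof (induction q)
  case (Cons f q)
  then have "fst f \<noteq> snd f" by (auto simp: gadget_edges_def)
  then have "inj_on (lift_vertex f) (tree_edge q)" using inj_lift_vertex inj_on_subset by blast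
  with Cons show ?case by (simp add: card_image)
qed (simp add: roots_def)

text \<open>Composing with \<open>lift_vertex\<close> turns an embedding of the tree into embeddings
  of the subtrees at the edges of its top clique. By induction these edges are present after
  \<open>t\<close> steps, and one further step restores the root edge.\<close>

lemma bootstrap_tree_copy:
  assumes "r \<ge> 4" "inj_on \<phi> (inner_vertices r t \<union> roots)"
    "\<phi> ` (inner_vertices r t \<union> roots) \<subseteq> {1..n}"
    "\<And>q. q \<in> paths r t \<Longrightarrow> \<phi> ` tree_edge q \<in> G"
  shows "\<phi> ` roots \<in> bootstrap n r G t"
  using assms(2-)
proof (induction t arbitrary: \<phi>)
  case 0
  then show ?case by (simp add: paths_def)
next
  case (Suc t)
  define top where "top = Pair ([] :: (nat \<times> nat) list) ` {..<r}"
  have top: "top \<subseteq> inner_vertices r (Suc t) \<union> roots"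
    using assms(1) by (auto simp: top_def inner_vertices_def roots_def)
  have roots_top: "roots \<subseteq> top" using assms(1) by (auto simp: top_def roots_def)
  have inj: "inj_on \<phi> top" using Suc.prems(1) top inj_on_subset by blast
  have card_top: "card top = r" by (simp add: top_def card_image inj_on_def)
  have edge: "\<phi> ` {([], a), ([], b)} \<in> bootstrap n r G t" if f: "(a, b) \<in> gadget_edges r" for a b
  proof -
    let ?l = "lift_vertex (a, b)" and ?D = "inner_vertices r t \<union> roots"
    have sub: "?l ` ?D \<subseteq> inner_vertices r (Suc t) \<union> roots"
      using lift_vertex_in[OF f] by blast
    have "a \<noteq> b" using f by (auto simp: gadget_edges_def)
    then have "inj_on ?l ?D" using inj_lift_vertex[of "(a, b)"] inj_on_subset by auto
    then have "inj_on (\<phi> \<circ> ?l) ?D"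
      using Suc.prems(1) sub by (intro comp_inj_on) (auto intro: inj_on_subset)
    moreover have "(\<phi> \<circ> ?l) ` ?D \<subseteq> {1..n}"
      using Suc.prems(2) sub by (auto simp: image_comp[symmetric])
    moreover have "(\<phi> \<circ> ?l) ` tree_edge q \<in> G" if "q \<in> paths r t" for q
      using Suc.prems(3)[of "(a, b) # q"] that f by (auto simp: paths_def image_comp)
    ultimately have "(\<phi> \<circ> ?l) ` roots \<in> bootstrap n r G t" by (rule Suc.IH)
    then show ?thesis by (simp add: roots_def)
  qed
  show ?case
  proof (rule bootstrap_SucI)
    show "\<phi> ` top \<subseteq> {1..n}" using Suc.prems(2) top by blast
    show "card (\<phi> ` top) = r" using inj card_top by (simp add: card_image)
    have "card (\<phi> ` roots) = 2"
      using inj_on_subset[OF inj roots_top] by (simp add: card_image) (simp add: roots_def)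
    then show "\<phi> ` roots \<in> complete_graph (\<phi> ` top)"
      using roots_top by (auto simp: complete_graph_def)
    show "complete_graph (\<phi> ` top) - {\<phi> ` roots} \<subseteq> bootstrap n r G t"
    proof
      fix e assume e: "e \<in> complete_graph (\<phi> ` top) - {\<phi> ` roots}"
      have inj': "inj_on (\<phi> \<circ> Pair []) {..<r}"
        using inj by (intro comp_inj_on) (auto simp: top_def inj_on_def)
      have "e \<subseteq> (\<phi> \<circ> Pair []) ` {..<r}"
        using e by (auto simp: complete_graph_def top_def image_comp)
      then obtain d where d: "d \<subseteq> {..<r}" "e = (\<phi> \<circ> Pair []) ` d"
        by (auto simp: subset_image_iff)
      then have "card d = 2"
        using e card_image[OF inj_on_subset[OF inj' d(1)]] by (simp add: complete_graph_def)
      moreover have "d \<noteq> {0, 1}" using e d(2) by (auto simp: roots_def)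
      ultimately obtain a b where "(a, b) \<in> gadget_edges r" "d = {a, b}"
        using gadget_edge_exists[OF d(1)] by blast
      then show "e \<in> bootstrap n r G t" using edge d(2) by simp
    qed
  qed
qed

subsection \<open>Balancedness of the tree\<close>

definition slice :: "(nat \<times> nat) list set \<Rightarrow> nat \<times> nat \<Rightarrow> (nat \<times> nat) list set" where
  "slice Q f = {q. f # q \<in> Q}"

definition tree_span :: "(nat \<times> nat) list set \<Rightarrow> tree_vertex set" where
  "tree_span Q = (\<Union>q\<in>Q. tree_edge q)"

text \<open>Vertices \<open>([], i)\<close> form the top clique, the only place where the subtrees
  at different clique edges can meet. The inductions on depth therefore see the slices of
  \<open>Q\<close> only through this set.\<close>

definition touched :: "(nat \<times> nat) list set \<Rightarrow> nat set" where
  "touched Q = {i. ([], i) \<in> tree_span Q}"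

lemma slice_subset: "Q \<subseteq> paths r (Suc t) \<Longrightarrow> slice Q f \<subseteq> paths r t"
  by (force simp: slice_def paths_def)

lemma paths_SucD: "q \<in> paths r (Suc t) \<Longrightarrow> \<exists>f q'. q = f # q' \<and> f \<in> gadget_edges r"
  by (cases q) (auto simp: paths_def)

lemma card_slices:
  assumes "Q \<subseteq> paths r (Suc t)"
  shows "card Q = (\<Sum>f\<in>gadget_edges r. card (slice Q f))"
proof -
  have fin: "finite (slice Q f)" for f by (rule finite_subset[OF slice_subset[OF assms] finite_paths])
  have "Q = (\<Union>f\<in>gadget_edges r. (#) f ` slice Q f)"
  proof
    show "Q \<subseteq> (\<Union>f\<in>gadget_edges r. (#) f ` slice Q f)"
    proof
      fix q assume q: "q \<in> Q"
      then obtain f q' where "q = f # q'" "f \<in> gadget_edges r"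
        using paths_SucD[OF subsetD[OF assms]] by metis
      with q show "q \<in> (\<Union>f\<in>gadget_edges r. (#) f ` slice Q f)"
        by (intro UN_I[of f] image_eqI[of _ _ q']) (auto simp: slice_def)
    qed
  qed (auto simp: slice_def)
  then have "card Q = card (\<Union>f\<in>gadget_edges r. (#) f ` slice Q f)" by simp
  also have "\<dots> = (\<Sum>f\<in>gadget_edges r. card ((#) f ` slice Q f))"
    using fin by (intro card_UN_disjoint) auto
  finally show ?thesis by (simp add: card_image)
qed

lemma tree_span_slices:
  assumes "Q \<subseteq> paths r (Suc t)"
  shows "tree_span Q = (\<Union>f\<in>gadget_edges r. lift_vertex f ` tree_span (slice Q f))"
proof
  show "tree_span Q \<subseteq> (\<Union>f\<in>gadget_edges r. lift_vertex f ` tree_span (slice Q f))"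
  proof
    fix v assume "v \<in> tree_span Q"
    then obtain q where q: "q \<in> Q" "v \<in> tree_edge q" by (auto simp: tree_span_def)
    then obtain f q' where "q = f # q'" "f \<in> gadget_edges r"
      using paths_SucD[OF subsetD[OF assms]] by metis
    with q show "v \<in> (\<Union>f\<in>gadget_edges r. lift_vertex f ` tree_span (slice Q f))"
      by (auto simp: slice_def tree_span_def)
  qed
  show "(\<Union>f\<in>gadget_edges r. lift_vertex f ` tree_span (slice Q f)) \<subseteq> tree_span Q"
  proof
    fix v assume "v \<in> (\<Union>f\<in>gadget_edges r. lift_vertex f ` tree_span (slice Q f))"
    then obtain f q where "f # q \<in> Q" "v \<in> lift_vertex f ` tree_edge q"
      by (auto simp: slice_def tree_span_def)
    then show "v \<in> tree_span Q" unfolding tree_span_def by (intro UN_I[of "f # q"]) auto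
  qed
qed

lemma tree_span_subset: "Q \<subseteq> paths r t \<Longrightarrow> tree_span Q \<subseteq> inner_vertices r t \<union> roots"
  unfolding tree_span_def using tree_edge_subset by blast

lemma finite_tree_span: "Q \<subseteq> paths r t \<Longrightarrow> finite (tree_span Q)"
  by (drule tree_span_subset) (auto simp: roots_def elim: finite_subset)

lemma touched_subset: "r \<ge> 4 \<Longrightarrow> Q \<subseteq> paths r t \<Longrightarrow> touched Q \<subseteq> {..<r}"
  using tree_span_subset[of Q r t] by (auto simp: touched_def inner_vertices_def roots_def)

lemma touched_slice:
  assumes "Q \<subseteq> paths r (Suc t)" "f \<in> gadget_edges r"
  shows "0 \<in> touched (slice Q f) \<Longrightarrow> fst f \<in> touched Q"
    and "1 \<in> touched (slice Q f) \<Longrightarrow> snd f \<in> touched Q"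
  using assms(2) unfolding touched_def tree_span_slices[OF assms(1)]
  by (force intro: rev_image_eqI)+

text \<open>Slices share only vertices of the top clique, and every deeper vertex carries its slice
  as first step of its path. The set \<open>I\<close> is empty when roots are counted and
  \<open>{0, 1}\<close> when they are free.\<close>

lemma card_tree_span_slices:
  assumes r: "r \<ge> 4" and Q: "Q \<subseteq> paths r (Suc t)"
  shows "card (tree_span Q - Pair [] ` I) = card (touched Q - I) +
    (\<Sum>f\<in>gadget_edges r. card (tree_span (slice Q f) - roots))"
proof -
  let ?X = "\<lambda>f. lift_vertex f ` (tree_span (slice Q f) - roots)"
  have fin: "finite (tree_span (slice Q f) - roots)" for f
    using finite_tree_span[OF slice_subset[OF Q]] by simp
  have lift_root: "lift_vertex f v \<in> range (Pair [])" if "v \<in> roots" for f v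
    using that by (auto simp: roots_def)
  have eq: "tree_span Q - Pair [] ` I = Pair [] ` (touched Q - I) \<union> (\<Union>f\<in>gadget_edges r. ?X f)"
  proof
    show "tree_span Q - Pair [] ` I \<subseteq> Pair [] ` (touched Q - I) \<union> (\<Union>f\<in>gadget_edges r. ?X f)"
    proof
      fix v assume v: "v \<in> tree_span Q - Pair [] ` I"
      then obtain f u where fu: "f \<in> gadget_edges r" "u \<in> tree_span (slice Q f)" "v = lift_vertex f u"
        using tree_span_slices[OF Q] by auto
      show "v \<in> Pair [] ` (touched Q - I) \<union> (\<Union>f\<in>gadget_edges r. ?X f)"
      proof (cases "u \<in> roots")
        case True
        then obtain i where "v = ([], i)" using lift_root fu by blast
        with v show ?thesis by (auto simp: touched_def)
      next
        case False
        with fu show ?thesis by blast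
      qed
    qed
    have "?X f \<subseteq> tree_span Q - Pair [] ` I" if "f \<in> gadget_edges r" for f
    proof -
      have "?X f \<subseteq> tree_span Q" using that tree_span_slices[OF Q] by blast
      then show ?thesis by auto
    qed
    then show "Pair [] ` (touched Q - I) \<union> (\<Union>f\<in>gadget_edges r. ?X f) \<subseteq> tree_span Q - Pair [] ` I"
      by (auto simp: touched_def)
  qed
  have fint: "finite (touched Q)" using touched_subset[OF r Q] finite_subset by blast
  have "card (tree_span Q - Pair [] ` I) =
      card (Pair ([] :: (nat \<times> nat) list) ` (touched Q - I)) + card (\<Union>f\<in>gadget_edges r. ?X f)"
    unfolding eq using fin fint by (intro card_Un_disjoint) auto
  also have "card (Pair ([] :: (nat \<times> nat) list) ` (touched Q - I)) = card (touched Q - I)"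
    by (simp add: card_image inj_on_def)
  also have "card (\<Union>f\<in>gadget_edges r. ?X f) = (\<Sum>f\<in>gadget_edges r. card (?X f))"
    using fin by (intro card_UN_disjoint) auto
  also have "\<dots> = (\<Sum>f\<in>gadget_edges r. card (tree_span (slice Q f) - roots))"
  proof (rule sum.cong)
    fix f assume "f \<in> gadget_edges r"
    then have "inj (lift_vertex f)" by (intro inj_lift_vertex) (auto simp: gadget_edges_def)
    then show "card (?X f) = card (tree_span (slice Q f) - roots)"
      by (intro card_image) (auto intro: inj_on_subset)
  qed simp
  finally show ?thesis .
qed

text \<open>A slice covering both ends of its clique edge contributes an extra 1; for any other
  slice a missing end, worth the slope, absorbs it. The extra ones number at most the pairs of
  touched vertices, controlled by \<open>choose_two_le_sparse_bound\<close>, or at most tau if all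
  \<open>r\<close> vertices are touched.\<close>

lemma edges_le_sparse_bound:
  assumes "r \<ge> 4"
  shows "Q \<subseteq> paths r t \<Longrightarrow> Q \<noteq> {} \<Longrightarrow> real (card Q) \<le> sparse_bound (slope r) (card (tree_span Q))"
proof (induction t arbitrary: Q)
  case 0
  then have "Q = {[]}" by (auto simp: paths_def)
  then show ?case by (simp add: tree_span_def roots_def sparse_bound_def)
next
  case (Suc t)
  note Q = Suc.prems(1)
  let ?P = "gadget_edges r" and ?a = "slope r" and ?k = "\<lambda>f. real (card (slice Q f))"
  let ?nv = "\<lambda>f. real (card (tree_span (slice Q f) - roots))"
  let ?s = "card (touched Q)"
  have a2: "?a \<ge> 2" by (rule slope_ge_2[OF assms])
  have fint: "finite (touched Q)" using touched_subset[OF assms Q] finite_subset by blast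
  have card_span: "real (card (tree_span Q)) = real ?s + (\<Sum>f\<in>?P. ?nv f)"
    using card_tree_span_slices[OF assms Q, of "{}"] by simp
  have card_Q: "real (card Q) = (\<Sum>f\<in>?P. ?k f)" by (simp add: card_slices[OF Q])
  define d where "d f = card (touched (slice Q f) \<inter> {0, 1})" for f
  have IH: "?k f \<le> ?a * (?nv f + real (d f) - 2) + 1" if "slice Q f \<noteq> {}" for f
  proof -
    have "card (tree_span (slice Q f)) = card (tree_span (slice Q f) \<inter> roots) + card (tree_span (slice Q f) - roots)"
      by (rule card_Int_Diff[OF finite_tree_span[OF slice_subset[OF Q]]])
    moreover have "tree_span (slice Q f) \<inter> roots = Pair [] ` (touched (slice Q f) \<inter> {0, 1})"
      by (auto simp: touched_def roots_def)
    then have "card (tree_span (slice Q f) \<inter> roots) = d f"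
      by (simp add: d_def card_image inj_on_def)
    ultimately have "real (card (tree_span (slice Q f))) = ?nv f + real (d f)" by simp
    with Suc.IH[OF slice_subset[OF Q] that] show ?thesis
      by (simp add: sparse_bound_def)
  qed
  have d_le: "d f \<le> 2" for f
    unfolding d_def by (rule order_trans[OF card_mono[of "{0, 1}"]]) auto
  have d_le_s: "d f \<le> ?s" if "f \<in> ?P" for f
    unfolding d_def
  proof (rule card_inj_on_le)
    show "inj_on (\<lambda>i. if i = 0 then fst f else snd f) (touched (slice Q f) \<inter> {0, 1})"
      using that by (auto simp: inj_on_def gadget_edges_def)
    show "(\<lambda>i. if i = 0 then fst f else snd f) ` (touched (slice Q f) \<inter> {0, 1}) \<subseteq> touched Q"
      using touched_slice[OF Q that] by auto
  qed (rule fint)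
  have light: "?k f \<le> ?a * ?nv f" if "d f \<noteq> 2" for f
  proof (cases "slice Q f = {}")
    case False
    have "real (d f) \<le> 1" using d_le[of f] that by linarith
    then have "?a * (?nv f + real (d f) - 2) \<le> ?a * (?nv f - 1)"
      using a2 by (intro mult_left_mono) auto
    with IH[OF False] have "?k f \<le> ?a * (?nv f - 1) + 1" by linarith
    with a2 show ?thesis by (simp add: algebra_simps)
  qed (use a2 in simp)
  show ?case
  proof (cases "?s \<ge> 2")
    case True
    define P2 where "P2 = {f \<in> ?P. d f = 2}"
    have "?k f \<le> ?a * ?nv f + (if f \<in> P2 then 1 else 0)" if "f \<in> ?P" for f
    proof (cases "f \<in> P2")
      case True
      then have "d f = 2" by (simp add: P2_def)
      moreover have "slice Q f \<noteq> {}"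
        using \<open>d f = 2\<close> by (auto simp: d_def touched_def tree_span_def)
      ultimately show ?thesis using IH[of f] True by simp
    next
      case False
      then show ?thesis using light that by (auto simp: P2_def)
    qed
    then have "real (card Q) \<le> (\<Sum>f\<in>?P. ?a * ?nv f + (if f \<in> P2 then 1 else 0))"
      unfolding card_Q by (intro sum_mono)
    also have "\<dots> = ?a * (\<Sum>f\<in>?P. ?nv f) + real (card P2)"
      by (simp add: sum.distrib sum_distrib_left sum.If_cases P2_def Collect_conj_eq Int_absorb1 Int_ac)
    also have "real (card P2) \<le> sparse_bound ?a ?s"
    proof (cases "?s < r")
      case s: True
      have "P2 \<subseteq> {(a, b). a < b \<and> a \<in> touched Q \<and> b \<in> touched Q}"
      proof
        fix f assume f: "f \<in> P2"
        then have "touched (slice Q f) \<inter> {0, 1} = {0, 1}"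
          by (intro card_seteq) (auto simp: P2_def d_def)
        then have "fst f \<in> touched Q" "snd f \<in> touched Q"
          using touched_slice[OF Q, of f] f by (auto simp: P2_def)
        moreover have "fst f < snd f" using f by (auto simp: P2_def gadget_edges_def)
        ultimately show "f \<in> {(a, b). a < b \<and> a \<in> touched Q \<and> b \<in> touched Q}" by auto
      qed
      then have "real (card P2) \<le> real (?s choose 2)"
        using card_ordered_pairs_le[OF fint] by simp
      also have "\<dots> \<le> sparse_bound ?a ?s" by (rule choose_two_le_sparse_bound[OF assms True s])
      finally show ?thesis .
    next
      case False
      then have "?s = r" using card_mono[OF _ touched_subset[OF assms Q]] by simp
      moreover have "card P2 \<le> card ?P" by (intro card_mono) (auto simp: P2_def)
      ultimately show ?thesis
        using sparse_bound_slope[OF assms] real_tau[OF assms] card_gadget_edges[OF assms] by simp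
    qed
    finally show ?thesis by (simp add: card_span sparse_bound_def algebra_simps)
  next
    case False
    \<comment> \<open>Below two touched vertices \<open>sparse_bound\<close> at \<open>?s\<close> is
      negative and cannot absorb a count of heavy slices. But then no slice covers both ends of its
      edge: one nonempty slice supplies the constant 1, and all others are light.\<close>
    obtain q where "q \<in> Q" using Suc.prems by blast
    then obtain f0 q0 where "f0 \<in> ?P" "q = f0 # q0" using Q paths_SucD[of q r t] by blast
    with \<open>q \<in> Q\<close> have f0: "f0 \<in> ?P" "q0 \<in> slice Q f0" by (auto simp: slice_def)
    have "real (card Q) = ?k f0 + (\<Sum>f\<in>?P - {f0}. ?k f)"
      unfolding card_Q using f0 by (simp add: sum.remove)
    also have "(\<Sum>f\<in>?P - {f0}. ?k f) \<le> (\<Sum>f\<in>?P - {f0}. ?a * ?nv f)"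
    proof (rule sum_mono)
      fix f assume "f \<in> ?P - {f0}"
      then have "d f \<noteq> 2" using d_le_s[of f] False by auto
      then show "?k f \<le> ?a * ?nv f" by (rule light)
    qed
    also have "?k f0 \<le> ?a * (?nv f0 + real ?s - 2) + 1"
    proof -
      have "?a * (?nv f0 + real (d f0) - 2) \<le> ?a * (?nv f0 + real ?s - 2)"
        using d_le_s[OF f0(1)] a2 by (intro mult_left_mono) auto
      with IH[of f0] f0 show ?thesis by force
    qed
    finally have "real (card Q) \<le> ?a * (?nv f0 + real ?s - 2) + 1 + ?a * (\<Sum>f\<in>?P - {f0}. ?nv f)"
      by (simp add: sum_distrib_left)
    also have "\<dots> = sparse_bound ?a (card (tree_span Q))"
      using f0 by (simp add: sparse_bound_def card_span sum.remove[of ?P f0] algebra_simps)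
    finally show ?thesis .
  qed
qed

text \<open>An uncovered root lowers the span by one vertex, worth at least 1, which cancels the
  constant in \<open>edges_le_sparse_bound\<close>.\<close>

lemma edges_le_inner_span:
  assumes r: "r \<ge> 4" and Q: "Q \<subseteq> paths r t" and nt: "\<not> {0, 1} \<subseteq> touched Q"
  shows "real (card Q) \<le> slope r * real (card (tree_span Q - roots))"
proof (cases "Q = {}")
  case False
  have "card (tree_span Q) = card (tree_span Q \<inter> roots) + card (tree_span Q - roots)"
    by (rule card_Int_Diff[OF finite_tree_span[OF Q]])
  moreover have "card (tree_span Q \<inter> roots) < card roots"
    using nt by (intro psubset_card_mono) (auto simp: touched_def roots_def)
  ultimately have "card (tree_span Q) \<le> 1 + card (tree_span Q - roots)" by (simp add: roots_def)
  then have "real (card (tree_span Q)) - 2 \<le> real (card (tree_span Q - roots)) - 1" by linarith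
  then have "slope r * (real (card (tree_span Q)) - 2) \<le> slope r * (real (card (tree_span Q - roots)) - 1)"
    using slope_ge_2[OF r] by (intro mult_left_mono) auto
  with edges_le_sparse_bound[OF r Q False] slope_ge_2[OF r] show ?thesis
    by (simp add: sparse_bound_def algebra_simps)
qed (use slope_ge_2[OF r] in simp)

text \<open>Peels off the top clique. Here \<open>s\<close> counts its touched vertices together
  with the two free roots, and \<open>x\<close> collects the correction terms of slices whose clique
  edge lies within them; other slices miss an end and need no correction by
  \<open>edges_le_inner_span\<close>. Each correction is at most 1, and there are at most
  \<open>s choose 2\<close> minus 1 of them, as the root pair is not a gadget edge.\<close>

lemma balanced_core:
  assumes r: "r \<ge> 4" and Q: "Q \<subseteq> paths r (Suc t)"
    and IH: "\<And>f. real (card (slice Q f)) \<le>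
      slope r * real (card (tree_span (slice Q f) - roots)) + real (card (slice Q f)) / tau r ^ t"
  shows "\<exists>s x. 2 \<le> s \<and> s \<le> r \<and> 0 \<le> x \<and> x \<le> (real s - 2) * (real s + 1) / 2 \<and>
    x \<le> real (card Q) / tau r ^ t \<and> (s = r \<longrightarrow> x = real (card Q) / tau r ^ t) \<and>
    real (card Q) \<le> slope r * (real (card (tree_span Q - roots)) - (real s - 2)) + x"
proof -
  let ?P = "gadget_edges r" and ?a = "slope r" and ?k = "\<lambda>f. real (card (slice Q f))"
  let ?nv = "\<lambda>f. real (card (tree_span (slice Q f) - roots))"
  define T where "T = touched Q \<union> {0, 1}"
  define A where "A = {f \<in> ?P. fst f \<in> T \<and> snd f \<in> T}"
  define x where "x = (\<Sum>f\<in>A. ?k f / tau r ^ t)"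
  have tau5: "tau r \<ge> 5" by (rule tau_ge_5[OF r])
  have T: "T \<subseteq> {..<r}" using touched_subset[OF r Q] r by (auto simp: T_def)
  then have finT: "finite T" using finite_subset by blast
  have s2: "2 \<le> card T" using card_mono[OF finT, of "{0, 1}"] by (simp add: T_def)
  have sr: "card T \<le> r" using card_mono[OF _ T] by simp
  have A: "finite A" "A \<subseteq> ?P" by (auto simp: A_def)
  have k_le: "?k f \<le> tau r ^ t" for f
  proof -
    have "card (slice Q f) \<le> ((r choose 2) - 1) ^ t"
      using card_mono[OF finite_paths slice_subset[OF Q]] card_paths[OF r] by metis
    then show ?thesis using real_tau[OF r] by (metis of_nat_le_iff of_nat_power)
  qed
  have card_Q: "real (card Q) = (\<Sum>f\<in>?P. ?k f)" by (simp add: card_slices[OF Q])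
  have "real (card Q) \<le> (\<Sum>f\<in>?P. ?a * ?nv f + (if f \<in> A then ?k f / tau r ^ t else 0))"
    unfolding card_Q
  proof (rule sum_mono)
    fix f assume f: "f \<in> ?P"
    show "?k f \<le> ?a * ?nv f + (if f \<in> A then ?k f / tau r ^ t else 0)"
    proof (cases "f \<in> A")
      case True
      then show ?thesis using IH[of f] by simp
    next
      case False
      then have "\<not> {0, 1} \<subseteq> touched (slice Q f)"
        using touched_slice[OF Q f] f by (auto simp: A_def T_def)
      then show ?thesis using edges_le_inner_span[OF r slice_subset[OF Q]] False by simp
    qed
  qed
  also have "\<dots> = ?a * (\<Sum>f\<in>?P. ?nv f) + x"
    using A by (simp add: sum.distrib sum_distrib_left sum.If_cases x_def Int_absorb1)
  also have "(\<Sum>f\<in>?P. ?nv f) = real (card (tree_span Q - roots)) - (real (card T) - 2)"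
  proof -
    have "card (touched Q - {0, 1}) = card (T - {0, 1})"
      by (rule arg_cong[where f = card]) (auto simp: T_def)
    also have "\<dots> = card T - 2" by (subst card_Diff_subset) (auto simp: T_def)
    finally show ?thesis
      using card_tree_span_slices[OF r Q, of "{0, 1}"] s2 by (simp add: roots_def of_nat_diff)
  qed
  finally have main: "real (card Q) \<le>
      ?a * (real (card (tree_span Q - roots)) - (real (card T) - 2)) + x" .
  have "x \<le> (\<Sum>f\<in>A. 1)"
    unfolding x_def using k_le tau5 by (intro sum_mono) simp
  also have "(\<Sum>f\<in>A. 1) \<le> real (card T choose 2) - 1"
  proof -
    have "insert (0, 1) A \<subseteq> {(a, b). a < b \<and> a \<in> T \<and> b \<in> T}"
      by (auto simp: A_def T_def gadget_edges_def)
    from card_ordered_pairs_le[OF finT this] have "card (insert (0, 1) A) \<le> card T choose 2" .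
    moreover have "(0, 1) \<notin> A" by (simp add: A_def gadget_edges_def)
    ultimately have "Suc (card A) \<le> card T choose 2" using A by simp
    then show ?thesis by simp
  qed
  also have "\<dots> = (real (card T) - 2) * (real (card T) + 1) / 2"
    by (simp add: real_choose_two field_simps)
  finally have x_le: "x \<le> (real (card T) - 2) * (real (card T) + 1) / 2" .
  have x_eq: "(\<Sum>f\<in>?P. ?k f / tau r ^ t) = real (card Q) / tau r ^ t"
    unfolding card_Q by (simp add: sum_divide_distrib)
  have "x \<le> real (card Q) / tau r ^ t"
    unfolding x_eq[symmetric] x_def using tau5 A by (intro sum_mono2) auto
  moreover have "x = real (card Q) / tau r ^ t" if "card T = r"
  proof -
    have "T = {..<r}" using T that by (intro card_subset_eq) auto
    then have "A = ?P" by (auto simp: A_def gadget_edges_def)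
    then show ?thesis using x_eq by (simp add: x_def)
  qed
  moreover have "0 \<le> x" using tau5 by (auto simp: x_def intro!: sum_nonneg)
  ultimately show ?thesis using s2 sr x_le main by blast
qed

text \<open>From tau/(r-2) = (r+1)/2 follows slope = (r+1)c with c = (1-1/tau)/2. At the largest
  admissible \<open>x\<close> the difference of the two main terms is exactly (s-2)(r-s)c: zero at
  both ends of the range, and at least c >= 1/tau in between.\<close>

lemma slope_mult_ge:
  assumes "r \<ge> 4" "2 \<le> s" "s \<le> r" "x \<le> (real s - 2) * (real s + 1) / 2"
  shows "x * (1 - 1 / tau r) \<le> slope r * (real s - 2) - (if s = r \<or> s = 2 then 0 else 1 / tau r)"
proof -
  have tau: "tau r \<ge> 5" by (rule tau_ge_5[OF assms(1)])
  define c where "c = (1 - 1 / tau r) / 2"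
  have c: "c \<ge> 0" "2 / tau r \<le> c * 2" using tau by (auto simp: c_def field_simps)
  have slope: "slope r = (real r + 1) * c"
  proof -
    have eq: "tau r / (real r - 2) = (real r + 1) / 2" using assms(1) by (simp add: tau_eq field_simps)
    have "slope r = (tau r / (real r - 2)) * (1 - 1 / tau r)"
      using tau assms(1) by (simp add: slope_def field_simps)
    then show ?thesis unfolding eq by (simp add: c_def)
  qed
  have "x * (1 - 1 / tau r) \<le> (real s - 2) * (real s + 1) / 2 * (1 - 1 / tau r)"
    using assms(4) tau by (intro mult_right_mono) auto
  also have "\<dots> = slope r * (real s - 2) - (real s - 2) * (real r - real s) * c"
  proof -
    have "(real s - 2) * (real s + 1) / 2 * (1 - 1 / tau r) = (real s - 2) * (real s + 1) * c"
      by (simp add: c_def)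
    then show ?thesis unfolding slope by (simp add: algebra_simps)
  qed
  also have "\<dots> \<le> slope r * (real s - 2) - (if s = r \<or> s = 2 then 0 else 1 / tau r)"
  proof -
    have "1 / tau r \<le> (real s - 2) * (real r - real s) * c" if "s \<noteq> r" "s \<noteq> 2"
    proof -
      have "1 * 1 * c \<le> (real s - 2) * (real r - real s) * c"
        using that assms c by (intro mult_right_mono mult_mono) auto
      with c show ?thesis by simp
    qed
    moreover have "0 \<le> (real s - 2) * (real r - real s) * c" using assms c by simp
    ultimately show ?thesis by auto
  qed
  finally show ?thesis .
qed

text \<open>Equivalently, at p = n^(-(1-tau^(-t))/slope) no set of leaf edges, with the roots fixed,
  has n^vertices p^edges below 1. In the induction \<open>x\<close> is split into x(1-1/tau), paid
  for by the vertices of the top clique, and x/tau, paid for by the correction term at depth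
  t+1.\<close>

lemma tree_balanced:
  assumes r: "r \<ge> 4" and Q: "Q \<subseteq> paths r t"
  shows "real (card Q) \<le> slope r * real (card (tree_span Q - roots)) + real (card Q) / tau r ^ t"
  using Q
proof (induction t arbitrary: Q)
  case 0
  then show ?case using slope_ge_2[OF r] by simp
next
  case (Suc t)
  have tau: "tau r \<ge> 5" by (rule tau_ge_5[OF r])
  obtain s x where sx: "2 \<le> s" "s \<le> r" "x \<le> (real s - 2) * (real s + 1) / 2"
      "x \<le> real (card Q) / tau r ^ t"
      "real (card Q) \<le> slope r * (real (card (tree_span Q - roots)) - (real s - 2)) + x"
    using balanced_core[OF r Suc.prems Suc.IH[OF slice_subset[OF Suc.prems]]] by blast
  have "x * (1 - 1 / tau r) \<le> slope r * (real s - 2)"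
    using slope_mult_ge[OF r sx(1-3)] tau by (auto split: if_splits simp: field_simps)
  moreover have "x / tau r \<le> (real (card Q) / tau r ^ t) / tau r"
    using sx(4) tau by (intro divide_right_mono) auto
  ultimately show ?case using sx(5) by (simp add: algebra_simps)
qed

text \<open>The gap has a different source in each case. For s = 2, \<open>x\<close> vanishes and
  the correction term of a nonempty \<open>Q\<close> is unspent; for s = r, at least one leaf is
  missing; for 2 < s < r, \<open>slope_mult_ge\<close> leaves 1/tau.\<close>

lemma tree_strictly_balanced:
  assumes r: "r \<ge> 4" and Q: "Q \<subseteq> paths r t" and t: "t \<ge> 1"
    and k: "Q \<noteq> {}" "Q \<noteq> paths r t"
  shows "real (card Q) + 1 / tau r ^ t \<le>
    slope r * real (card (tree_span Q - roots)) + real (card Q) / tau r ^ t"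
proof -
  obtain u where u: "t = Suc u" using t by (cases t) auto
  note Q' = Q[unfolded u]
  have tau: "tau r \<ge> 5" by (rule tau_ge_5[OF r])
  have "card Q < card (paths r t)" using Q k by (intro psubset_card_mono) auto
  then have "card Q + 1 \<le> ((r choose 2) - 1) ^ t" by (simp add: card_paths[OF r])
  then have "real (card Q + 1) \<le> real (((r choose 2) - 1) ^ t)" by (rule of_nat_mono)
  then have k_lt: "real (card Q) + 1 \<le> tau r ^ t" unfolding of_nat_power real_tau[OF r] by simp
  have "card Q \<noteq> 0" using k Q finite_subset[OF Q] by auto
  then have k_gt: "real (card Q) \<ge> 1" by simp
  obtain s x where sx: "2 \<le> s" "s \<le> r" "0 \<le> x" "x \<le> (real s - 2) * (real s + 1) / 2"
      "x \<le> real (card Q) / tau r ^ u" "s = r \<Longrightarrow> x = real (card Q) / tau r ^ u"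
      "real (card Q) \<le> slope r * (real (card (tree_span Q - roots)) - (real s - 2)) + x"
    using balanced_core[OF r Q' tree_balanced[OF r slice_subset[OF Q']]] by blast
  have bound: "x * (1 - 1 / tau r) \<le> slope r * (real s - 2) - (if s = r \<or> s = 2 then 0 else 1 / tau r)"
    by (rule slope_mult_ge[OF r sx(1,2,4)])
  have x_tau: "x / tau r \<le> real (card Q) / tau r ^ t"
    using divide_right_mono[OF sx(5), of "tau r"] tau by (simp add: u mult.commute)
  have "x + 1 / tau r ^ t \<le> slope r * (real s - 2) + real (card Q) / tau r ^ t"
  proof -
    consider "s = 2" | "s = r" | "s \<noteq> 2" "s \<noteq> r" by blast
    then show ?thesis
    proof cases
      case 1
      then have "x = 0" using sx(3,4) by simp
      then show ?thesis using 1 k_gt tau by (simp add: divide_right_mono)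
    next
      case 2
      have x_eq: "x = tau r * (real (card Q) / tau r ^ t)"
        using sx(6)[OF 2] tau by (simp add: u)
      have "real (card Q) / tau r ^ t \<le> (tau r ^ t - 1) / tau r ^ t"
        using k_lt tau by (intro divide_right_mono) auto
      then have y: "real (card Q) / tau r ^ t \<le> 1 - 1 / tau r ^ t"
        using tau by (simp add: diff_divide_distrib)
      have "x + 1 / tau r ^ t - real (card Q) / tau r ^ t =
          (tau r - 1) * (real (card Q) / tau r ^ t) + 1 / tau r ^ t"
        unfolding x_eq by (simp only: left_diff_distrib mult_1)
      also have "\<dots> \<le> (tau r - 1) * (1 - 1 / tau r ^ t) + 1 / tau r ^ t"
        using y tau by (intro add_mono mult_left_mono) auto
      also have "\<dots> = (tau r - 1) - (tau r - 2) * (1 / tau r ^ t)"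
      proof -
        have "(a - 1) * (1 - z) + z = (a - 1) - (a - 2) * z" for a z :: real
          by (simp add: algebra_simps)
        then show ?thesis .
      qed
      also have "\<dots> \<le> tau r - 1" using tau by simp
      also have "\<dots> = slope r * (real s - 2)" using r 2 by (simp add: slope_def)
      finally show ?thesis by simp
    next
      case 3
      have "1 / tau r ^ t \<le> 1 / tau r" using tau t by (simp add: frac_le self_le_power)
      then show ?thesis using bound x_tau 3 by (simp add: algebra_simps)
    qed
  qed
  with sx(7) show ?thesis by (simp add: algebra_simps)
qed

text \<open>Two leaves on the same vertex pair would be two edges on two vertices, where
  \<open>edges_le_sparse_bound\<close> allows only one.\<close>

lemma inj_on_tree_edge:
  assumes r: "r \<ge> 4"
  shows "inj_on tree_edge (paths r t)"
proof (rule inj_onI, rule ccontr)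
  fix p q assume pq: "p \<in> paths r t" "q \<in> paths r t" "tree_edge p = tree_edge q" "p \<noteq> q"
  have "card (tree_span {p, q}) = 2"
    using pq card_tree_edge[of p r] by (simp add: tree_span_def paths_def)
  with edges_le_sparse_bound[OF r, of "{p, q}" t] pq show False by (simp add: sparse_bound_def)
qed

subsection \<open>Second moment method for rooted copies\<close>

lemma prob_blocks_pair:
  assumes A: "finite A" "B \<subseteq> A"
    and P: "\<And>f g. (\<And>x. x \<in> B \<Longrightarrow> f x = g x) \<Longrightarrow> P f = P g"
    and Q: "\<And>f g. (\<And>x. x \<in> A - B \<Longrightarrow> f x = g x) \<Longrightarrow> Q f = Q g"
  shows "measure_pmf.prob (Pi_pmf A d p) {f. P f \<and> Q f} =
    measure_pmf.prob (Pi_pmf A d p) {f. P f} * measure_pmf.prob (Pi_pmf A d p) {f. Q f}"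
proof -
  let ?h = "\<lambda>(f, g) x. if x \<in> B then f x else g x"
  let ?MB = "Pi_pmf B d p" and ?MC = "Pi_pmf (A - B) d p"
  have eq: "Pi_pmf A d p = map_pmf ?h (pair_pmf ?MB ?MC)"
    using Pi_pmf_union[of B "A - B" d p] A finite_subset[OF A(2,1)] by (simp add: Un_absorb1)
  have prod: "measure_pmf.prob (Pi_pmf A d p) {f. P' f \<and> Q' f} =
      measure_pmf.prob ?MB {f. P' f} * measure_pmf.prob ?MC {g. Q' g}"
    if P': "\<And>f g. (\<And>x. x \<in> B \<Longrightarrow> f x = g x) \<Longrightarrow> P' f = P' g"
    and Q': "\<And>f g. (\<And>x. x \<in> A - B \<Longrightarrow> f x = g x) \<Longrightarrow> Q' f = Q' g" for P' Q'
  proof -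
    have 1: "P' (?h (f, g)) = P' f" for f g by (rule P') auto
    have 2: "Q' (?h (f, g)) = Q' g" for f g by (rule Q') auto
    have "measure_pmf.prob (Pi_pmf A d p) {f. P' f \<and> Q' f} =
        measure_pmf.prob (pair_pmf ?MB ?MC) ({f. P' f} \<times> {g. Q' g})"
      unfolding eq measure_map_pmf by (rule arg_cong[where f = "measure _"]) (use 1 2 in auto)
    \<comment> \<open>Cutting down to the supports supplies the countable sets needed for the
      product formula.\<close>
    also have "\<dots> = measure_pmf.prob (pair_pmf ?MB ?MC)
        (({f. P' f} \<inter> set_pmf ?MB) \<times> ({g. Q' g} \<inter> set_pmf ?MC))"
      by (intro measure_prob_cong_0) (auto simp: pmf_eq_0_set_pmf)
    also have "\<dots> = measure_pmf.prob ?MB ({f. P' f} \<inter> set_pmf ?MB) *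
        measure_pmf.prob ?MC ({g. Q' g} \<inter> set_pmf ?MC)"
      by (rule measure_pmf_prob_product) (auto intro: countable_Int2)
    finally show ?thesis by (simp add: measure_Int_set_pmf)
  qed
  \<comment> \<open>Taking one of the two events trivial identifies the block probabilities with
    probabilities in the full product.\<close>
  have "measure_pmf.prob (Pi_pmf A d p) {f. P f \<and> Q f} =
      measure_pmf.prob ?MB {f. P f} * measure_pmf.prob ?MC {g. Q g}"
    by (rule prod) (rule P Q, blast)+
  moreover have "measure_pmf.prob (Pi_pmf A d p) {f. P f \<and> True} =
      measure_pmf.prob ?MB {f. P f} * measure_pmf.prob ?MC {g. True}"
    by (rule prod) (rule P, blast, simp)
  moreover have "measure_pmf.prob (Pi_pmf A d p) {f. True \<and> Q f} =
      measure_pmf.prob ?MB {f. True} * measure_pmf.prob ?MC {g. Q g}"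
    by (rule prod) (simp, rule Q, blast)
  ultimately show ?thesis by simp
qed

lemma prob_disjoint_edge_sets:
  assumes I: "finite I" and disj: "disjoint_family_on E I"
    and P: "\<And>i G. i \<in> I \<Longrightarrow> P i G = P i (G \<inter> E i)"
  shows "measure_pmf.prob (random_graph n p) {G. \<forall>i\<in>I. P i G} =
    (\<Prod>i\<in>I. measure_pmf.prob (random_graph n p) {G. P i G})"
  using assms
proof (induction I)
  case (insert i I)
  let ?g = "\<lambda>X. {e \<in> K n. X e}" and ?M = "Pi_pmf (K n) False (\<lambda>_. bernoulli_pmf p)"
  have disj: "E j \<inter> E i = {}" if "j \<in> I" for j
    using insert.prems(1) insert.hyps that unfolding disjoint_family_on_def by (metis insertCI)
  have "measure_pmf.prob ?M {X. P i (?g X) \<and> (\<forall>j\<in>I. P j (?g X))} =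
      measure_pmf.prob ?M {X. P i (?g X)} * measure_pmf.prob ?M {X. \<forall>j\<in>I. P j (?g X)}"
  proof (rule prob_blocks_pair[where B = "K n \<inter> E i"])
    fix X Y :: "nat set \<Rightarrow> bool"
    assume "\<And>e. e \<in> K n \<inter> E i \<Longrightarrow> X e = Y e"
    then have "?g X \<inter> E i = ?g Y \<inter> E i" by auto
    then show "P i (?g X) = P i (?g Y)" using insert.prems(2) by (metis insertI1)
  next
    fix X Y :: "nat set \<Rightarrow> bool"
    assume "\<And>e. e \<in> K n - K n \<inter> E i \<Longrightarrow> X e = Y e"
    then have "?g X \<inter> E j = ?g Y \<inter> E j" if "j \<in> I" for j using disj[OF that] by auto
    then have "P j (?g X) = P j (?g Y)" if "j \<in> I" for j
      using insert.prems(2)[of j "?g X"] insert.prems(2)[of j "?g Y"] that by simp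
    then show "(\<forall>j\<in>I. P j (?g X)) = (\<forall>j\<in>I. P j (?g Y))" by simp
  qed auto
  then have "measure_pmf.prob (random_graph n p) {G. \<forall>j\<in>insert i I. P j G} =
      measure_pmf.prob (random_graph n p) {G. P i G} *
      measure_pmf.prob (random_graph n p) {G. \<forall>j\<in>I. P j G}"
    unfolding random_graph_def measure_map_pmf by (simp add: vimage_def)
  also have "measure_pmf.prob (random_graph n p) {G. \<forall>j\<in>I. P j G} =
      (\<Prod>j\<in>I. measure_pmf.prob (random_graph n p) {G. P j G})"
  proof (rule insert.IH)
    show "disjoint_family_on E I"
      using insert.prems(1) by (rule disjoint_family_on_mono[rotated]) auto
    show "P j G = P j (G \<inter> E j)" if "j \<in> I" for j G using insert.prems(2) that by blast
  qed
  finally show ?case using insert.hyps by simp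
qed simp

text \<open>Edges are indexed through \<open>ed\<close> so that leaves can be addressed by paths.
  Excluding edges inside \<open>R\<close> keeps the root pair out of every copy; otherwise copies
  over disjoint vertex sets could share that edge.\<close>

locale rooted_graph =
  fixes E :: "'q set" and ed :: "'q \<Rightarrow> 'v set" and V R :: "'v set"
  assumes finite_E: "finite E" and finite_V: "finite V" and V_R: "V \<inter> R = {}"
    and ed_subset: "q \<in> E \<Longrightarrow> ed q \<subseteq> V \<union> R" and card_ed: "q \<in> E \<Longrightarrow> card (ed q) = 2"
    and inj_ed: "inj_on ed E" and not_root_edge: "q \<in> E \<Longrightarrow> \<not> ed q \<subseteq> R"
begin

definition embeddings :: "nat set \<Rightarrow> ('v \<Rightarrow> nat) set" where
  "embeddings S = {\<phi> \<in> V \<rightarrow>\<^sub>E S. inj_on \<phi> V}"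

definition extend :: "('v \<Rightarrow> nat) \<Rightarrow> ('v \<Rightarrow> nat) \<Rightarrow> 'v \<Rightarrow> nat" where
  "extend \<rho> \<phi> v = (if v \<in> R then \<rho> v else \<phi> v)"

definition copy :: "('v \<Rightarrow> nat) \<Rightarrow> ('v \<Rightarrow> nat) \<Rightarrow> nat set set" where
  "copy \<rho> \<phi> = (\<lambda>q. extend \<rho> \<phi> ` ed q) ` E"

lemma finite_embeddings: "finite S \<Longrightarrow> finite (embeddings S)"
  unfolding embeddings_def using finite_PiE[OF finite_V, of "\<lambda>_. S"] by simp

lemma card_embeddings_ge:
  assumes "finite S" "2 * card V \<le> card S"
  shows "(real (card S) / 2) ^ card V \<le> real (card (embeddings S))"
proof -
  have "card (embeddings S) = (\<Prod>i<card V. card S - i)"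
    unfolding embeddings_def
    using card_inj_on_subset_funcset[OF finite_V assms(1) order_refl]
    by (simp add: atLeast0LessThan)
  then have "real (card (embeddings S)) = (\<Prod>i<card V. real (card S - i))" by simp
  moreover have "(\<Prod>i<card V. real (card S) / 2) \<le> (\<Prod>i<card V. real (card S - i))"
    using assms(2) by (intro prod_mono) (auto simp: of_nat_diff)
  ultimately show ?thesis by simp
qed

context
  fixes \<rho> :: "'v \<Rightarrow> nat" and S :: "nat set" and n :: nat
  assumes inj_root: "inj_on \<rho> R" and S: "S \<subseteq> {1..n}" and root_range: "\<rho> ` R \<subseteq> {1..n} - S"
begin

lemma extend_in:
  assumes "\<phi> \<in> embeddings S"
  shows "v \<in> V \<Longrightarrow> extend \<rho> \<phi> v \<in> S" and "v \<in> R \<Longrightarrow> extend \<rho> \<phi> v \<in> \<rho> ` R"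
  using assms V_R by (auto simp: extend_def embeddings_def)

lemma inj_extend:
  assumes "\<phi> \<in> embeddings S"
  shows "inj_on (extend \<rho> \<phi>) (V \<union> R)"
proof (rule inj_onI)
  fix u v assume uv: "u \<in> V \<union> R" "v \<in> V \<union> R" "extend \<rho> \<phi> u = extend \<rho> \<phi> v"
  consider "u \<in> V" "v \<in> V" | "u \<in> R" "v \<in> R" | "u \<in> V" "v \<in> R" | "u \<in> R" "v \<in> V"
    using uv by blast
  then show "u = v"
  proof cases
    case 1
    then have "u \<notin> R" "v \<notin> R" using V_R by auto
    then have "\<phi> u = \<phi> v" "inj_on \<phi> V"
      using uv assms by (simp_all add: extend_def embeddings_def)
    with 1 show ?thesis by (auto dest: inj_onD)
  next
    case 2
    with uv inj_root show ?thesis by (auto simp: extend_def dest: inj_onD)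
  next
    case 3
    with extend_in[OF assms] have "extend \<rho> \<phi> u \<in> S" "extend \<rho> \<phi> v \<in> \<rho> ` R" by auto
    with uv root_range show ?thesis by auto
  next
    case 4
    with extend_in[OF assms] have "extend \<rho> \<phi> v \<in> S" "extend \<rho> \<phi> u \<in> \<rho> ` R" by auto
    with uv root_range show ?thesis by auto
  qed
qed

lemma inj_image_edges:
  assumes "\<phi> \<in> embeddings S"
  shows "inj_on (\<lambda>q. extend \<rho> \<phi> ` ed q) E"
  using inj_on_image_eq_iff[OF inj_extend[OF assms] ed_subset ed_subset] inj_ed
  by (auto simp: inj_on_def)

lemma card_copy: "\<phi> \<in> embeddings S \<Longrightarrow> card (copy \<rho> \<phi>) = card E"
  unfolding copy_def by (rule card_image[OF inj_image_edges])

lemma finite_copy: "finite (copy \<rho> \<phi>)"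
  by (simp add: copy_def finite_E)

lemma copy_subset:
  assumes "\<phi> \<in> embeddings S"
  shows "copy \<rho> \<phi> \<subseteq> complete_graph (S \<union> \<rho> ` R) - {\<rho> ` R}"
proof
  fix e assume "e \<in> copy \<rho> \<phi>"
  then obtain q where q: "q \<in> E" "e = extend \<rho> \<phi> ` ed q" by (auto simp: copy_def)
  have "e \<subseteq> S \<union> \<rho> ` R" using q ed_subset[OF q(1)] extend_in[OF assms] by blast
  moreover have "card e = 2"
    using q card_ed inj_on_subset[OF inj_extend[OF assms] ed_subset] by (simp add: card_image)
  moreover obtain v where "v \<in> ed q" "v \<in> V" using not_root_edge[OF q(1)] ed_subset[OF q(1)] by blast
  then have "extend \<rho> \<phi> v \<in> e - \<rho> ` R" using q extend_in[OF assms] root_range by blast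
  ultimately show "e \<in> complete_graph (S \<union> \<rho> ` R) - {\<rho> ` R}" by (auto simp: complete_graph_def)
qed

lemma copy_subset_K: "\<phi> \<in> embeddings S \<Longrightarrow> copy \<rho> \<phi> \<subseteq> K n"
  using copy_subset complete_graph_mono[of "S \<union> \<rho> ` R" "{1..n}"] S root_range by blast

text \<open>A non-root vertex on an edge of \<open>D\<close> goes into \<open>S\<close>, so in the
  copy of \<phi> it can only match an image of \<open>V\<close>, leaving \<open>card V\<close>
  choices. Each remaining vertex has at most \<open>card S\<close> choices.\<close>

lemma card_overlapping_le:
  assumes \<phi>: "\<phi> \<in> embeddings S" and D: "D \<subseteq> E"
  shows "card {\<psi> \<in> embeddings S. \<forall>q\<in>D. extend \<rho> \<psi> ` ed q \<in> copy \<rho> \<phi>} \<le>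
    card V ^ card (\<Union>(ed ` D) - R) * card S ^ (card V - card (\<Union>(ed ` D) - R))"
proof -
  let ?J = "\<Union>(ed ` D) - R"
  have J: "?J \<subseteq> V" using D ed_subset by blast
  have finS: "finite S" using S finite_subset by blast
  have "{\<psi> \<in> embeddings S. \<forall>q\<in>D. extend \<rho> \<psi> ` ed q \<in> copy \<rho> \<phi>} \<subseteq>
      (\<Pi>\<^sub>E v\<in>V. if v \<in> ?J then \<phi> ` V else S)"
  proof
    fix \<psi> assume "\<psi> \<in> {\<psi> \<in> embeddings S. \<forall>q\<in>D. extend \<rho> \<psi> ` ed q \<in> copy \<rho> \<phi>}"
    then have \<psi>: "\<psi> \<in> embeddings S" "\<And>q. q \<in> D \<Longrightarrow> extend \<rho> \<psi> ` ed q \<in> copy \<rho> \<phi>" by auto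
    have "\<psi> v \<in> \<phi> ` V" if v: "v \<in> ?J" for v
    proof -
      obtain q where q: "q \<in> D" "v \<in> ed q" using v by blast
      then obtain q' where q': "q' \<in> E" "extend \<rho> \<psi> ` ed q = extend \<rho> \<phi> ` ed q'"
        using \<psi>(2)[OF q(1)] unfolding copy_def by blast
      then obtain u where u: "u \<in> ed q'" "extend \<rho> \<psi> v = extend \<rho> \<phi> u" using q by blast
      have "v \<in> V" using J v by blast
      then have "extend \<rho> \<phi> u \<in> S" using u extend_in(1)[OF \<psi>(1)] by metis
      then have "u \<notin> R" using extend_in(2)[OF \<phi>] root_range by blast
      then have "u \<in> V" using u ed_subset[OF q'(1)] by blast
      then show ?thesis using u v V_R by (auto simp: extend_def)
    qed
    then show "\<psi> \<in> (\<Pi>\<^sub>E v\<in>V. if v \<in> ?J then \<phi> ` V else S)"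
      using \<psi>(1) by (auto simp: embeddings_def PiE_iff)
  qed
  then have "card {\<psi> \<in> embeddings S. \<forall>q\<in>D. extend \<rho> \<psi> ` ed q \<in> copy \<rho> \<phi>} \<le>
      card (\<Pi>\<^sub>E v\<in>V. if v \<in> ?J then \<phi> ` V else S)"
    using finite_V finS by (intro card_mono finite_PiE) auto
  also have "\<dots> = (\<Prod>v\<in>V. if v \<in> ?J then card (\<phi> ` V) else card S)"
    by (simp add: card_PiE[OF finite_V] if_distrib cong: if_cong)
  also have "\<dots> \<le> (\<Prod>v\<in>V. if v \<in> ?J then card V else card S)"
    using card_image_le[OF finite_V] by (intro prod_mono) auto
  also have "\<dots> = card V ^ card ?J * card S ^ (card V - card ?J)"
  proof -
    have "V \<inter> {v. v \<in> ?J} = ?J" "V \<inter> - {v. v \<in> ?J} = V - ?J" using J by auto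
    moreover have "card (V - ?J) = card V - card ?J"
      using J finite_V by (intro card_Diff_subset) (auto intro: finite_subset)
    ultimately show ?thesis using finite_V by (simp only: prod.If_cases prod_constant)
  qed
  finally show ?thesis .
qed

text \<open>Overlaps are indexed by the set \<open>D\<close> of edges of the second copy that fall
  into the first, not by isomorphism type. Since \<psi> is counted for every nonempty subset of its
  overlap, this is only an upper bound, but it needs no analysis of intersection patterns.\<close>

definition overlap_sum :: "real \<Rightarrow> real" where
  "overlap_sum p = (\<Sum>D\<in>Pow E - {{}}. real (card V ^ card (\<Union>(ed ` D) - R) *
     card S ^ (card V - card (\<Union>(ed ` D) - R))) / p ^ card D)"

lemma sum_overlaps_le:
  assumes \<phi>: "\<phi> \<in> embeddings S" and p: "0 < p"
  shows "(\<Sum>\<psi>\<in>embeddings S. if copy \<rho> \<phi> \<inter> copy \<rho> \<psi> = {} then 0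
      else 1 / p ^ card (copy \<rho> \<phi> \<inter> copy \<rho> \<psi>)) \<le> overlap_sum p"
proof -
  have finS: "finite (embeddings S)" using S finite_subset finite_embeddings by blast
  define D where "D \<psi> = {q \<in> E. extend \<rho> \<psi> ` ed q \<in> copy \<rho> \<phi>}" for \<psi>
  have D_card: "card (copy \<rho> \<phi> \<inter> copy \<rho> \<psi>) = card (D \<psi>)" if "\<psi> \<in> embeddings S" for \<psi>
  proof -
    have "copy \<rho> \<phi> \<inter> copy \<rho> \<psi> = (\<lambda>q. extend \<rho> \<psi> ` ed q) ` D \<psi>"
      by (auto simp: copy_def[of \<rho> \<psi>] D_def)
    moreover have "inj_on (\<lambda>q. extend \<rho> \<psi> ` ed q) (D \<psi>)"
      by (rule inj_on_subset[OF inj_image_edges[OF that]]) (auto simp: D_def)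
    ultimately show ?thesis by (simp add: card_image)
  qed
  have "(\<Sum>\<psi>\<in>embeddings S. if copy \<rho> \<phi> \<inter> copy \<rho> \<psi> = {} then 0
      else 1 / p ^ card (copy \<rho> \<phi> \<inter> copy \<rho> \<psi>)) \<le>
      (\<Sum>\<psi>\<in>embeddings S. \<Sum>D\<in>Pow E - {{}}.
        if \<forall>q\<in>D. extend \<rho> \<psi> ` ed q \<in> copy \<rho> \<phi> then 1 / p ^ card D else 0)"
    (is "_ \<le> (\<Sum>\<psi>\<in>embeddings S. \<Sum>D\<in>Pow E - {{}}. ?f \<psi> D)")
  proof (rule sum_mono)
    fix \<psi> assume \<psi>: "\<psi> \<in> embeddings S"
    have nonneg: "0 \<le> ?f \<psi> D'" for D' using p by simp
    show "(if copy \<rho> \<phi> \<inter> copy \<rho> \<psi> = {} then 0 else 1 / p ^ card (copy \<rho> \<phi> \<inter> copy \<rho> \<psi>)) \<le>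
        (\<Sum>D\<in>Pow E - {{}}. ?f \<psi> D)"
    proof (cases "copy \<rho> \<phi> \<inter> copy \<rho> \<psi> = {}")
      case True
      then show ?thesis using sum_nonneg[OF nonneg] by simp
    next
      case False
      then have "card (copy \<rho> \<phi> \<inter> copy \<rho> \<psi>) \<noteq> 0" using finite_copy by simp
      then have "D \<psi> \<noteq> {}" using D_card[OF \<psi>] by auto
      then have "D \<psi> \<in> Pow E - {{}}" by (auto simp: D_def)
      then have "?f \<psi> (D \<psi>) \<le> (\<Sum>D\<in>Pow E - {{}}. ?f \<psi> D)"
        using finite_E nonneg by (intro member_le_sum) auto
      then show ?thesis using False D_card[OF \<psi>] by (simp add: D_def)
    qed
  qed
  also have "\<dots> = (\<Sum>D\<in>Pow E - {{}}. \<Sum>\<psi>\<in>embeddings S. ?f \<psi> D)" by (rule sum.swap)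
  also have "\<dots> \<le> overlap_sum p"
    unfolding overlap_sum_def
  proof (rule sum_mono)
    fix D assume "D \<in> Pow E - {{}}"
    then have D: "D \<subseteq> E" by simp
    have "(\<Sum>\<psi>\<in>embeddings S. ?f \<psi> D) =
        real (card {\<psi> \<in> embeddings S. \<forall>q\<in>D. extend \<rho> \<psi> ` ed q \<in> copy \<rho> \<phi>}) / p ^ card D"
      unfolding sum.inter_filter[OF finS, symmetric] by simp
    also have "\<dots> \<le> real (card V ^ card (\<Union>(ed ` D) - R) *
        card S ^ (card V - card (\<Union>(ed ` D) - R))) / p ^ card D"
      using card_overlapping_le[OF \<phi> D] p by (intro divide_right_mono of_nat_mono) auto
    finally show "(\<Sum>\<psi>\<in>embeddings S. ?f \<psi> D) \<le> real (card V ^ card (\<Union>(ed ` D) - R) *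
        card S ^ (card V - card (\<Union>(ed ` D) - R))) / p ^ card D" .
  qed
  finally show ?thesis .
qed

text \<open>Chebyshev's inequality: on the event \<open>?Z\<close> the count \<open>X\<close>
  vanishes, so mu^2 times its probability is at most the variance of \<open>X\<close>, which the
  overlapping pairs bound by mu^2 \<open>overlap_sum p\<close> / N.\<close>

lemma prob_no_copy_le:
  assumes p: "0 < p" "p \<le> 1" and ne: "embeddings S \<noteq> {}"
  shows "measure_pmf.prob (random_graph n p) {G. \<forall>\<phi>\<in>embeddings S. \<not> copy \<rho> \<phi> \<subseteq> G} \<le>
    overlap_sum p / real (card (embeddings S))"
proof -
  let ?M = "random_graph n p" and ?\<Phi> = "embeddings S" and ?c = "copy \<rho>"
  define X where "X G = (\<Sum>\<phi>\<in>?\<Phi>. indicator {G. ?c \<phi> \<subseteq> G} G :: real)" for G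
  define N where "N = real (card ?\<Phi>)"
  define \<mu> where "\<mu> = N * p ^ card E"
  have fin\<Phi>: "finite ?\<Phi>" using S finite_subset finite_embeddings by blast
  have N: "N > 0" using ne fin\<Phi> by (simp add: N_def card_gt_0_iff)
  have \<mu>: "\<mu> > 0" using N p by (simp add: \<mu>_def)
  have fin_supp: "finite (set_pmf ?M)"
    by (rule finite_subset[of _ "Pow (K n)"]) (use set_pmf_random_graph in auto)
  have int: "integrable (measure_pmf ?M) f" for f :: "nat set set \<Rightarrow> real"
    by (rule integrable_measure_pmf_finite[OF fin_supp])
  have E1: "measure_pmf.expectation ?M (indicator {G. ?c \<phi> \<subseteq> G}) = p ^ card E" if "\<phi> \<in> ?\<Phi>" for \<phi>
    using that p prob_superset[OF _ _ copy_subset_K] card_copy by simp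
  have E2: "measure_pmf.expectation ?M (\<lambda>G. indicator {G. ?c \<phi> \<subseteq> G} G * indicator {G. ?c \<psi> \<subseteq> G} G) =
      p ^ (2 * card E) / p ^ card (?c \<phi> \<inter> ?c \<psi>)" if "\<phi> \<in> ?\<Phi>" "\<psi> \<in> ?\<Phi>" for \<phi> \<psi>
  proof -
    have "(\<lambda>G. indicator {G. ?c \<phi> \<subseteq> G} G * indicator {G. ?c \<psi> \<subseteq> G} G :: real) =
        indicator {G. ?c \<phi> \<union> ?c \<psi> \<subseteq> G}"
      by (auto simp: indicator_def fun_eq_iff)
    then have "measure_pmf.expectation ?M (\<lambda>G. indicator {G. ?c \<phi> \<subseteq> G} G * indicator {G. ?c \<psi> \<subseteq> G} G) =
        p ^ card (?c \<phi> \<union> ?c \<psi>)"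
      using p prob_superset[of p "?c \<phi> \<union> ?c \<psi>" n] copy_subset_K that by simp
    moreover have "card (?c \<phi> \<union> ?c \<psi>) + card (?c \<phi> \<inter> ?c \<psi>) = 2 * card E"
      using card_Un_Int[OF finite_copy finite_copy, of \<phi> \<psi>] card_copy that by simp
    then have "p ^ card (?c \<phi> \<union> ?c \<psi>) * p ^ card (?c \<phi> \<inter> ?c \<psi>) = p ^ (2 * card E)"
      by (simp add: power_add[symmetric])
    ultimately show ?thesis using p by (simp add: field_simps)
  qed
  have EX: "measure_pmf.expectation ?M X = \<mu>"
    unfolding X_def using int E1 by (subst Bochner_Integration.integral_sum) (auto simp: \<mu>_def N_def)
  have "measure_pmf.expectation ?M (\<lambda>G. X G * X G) =
      (\<Sum>\<phi>\<in>?\<Phi>. \<Sum>\<psi>\<in>?\<Phi>. p ^ (2 * card E) / p ^ card (?c \<phi> \<inter> ?c \<psi>))"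
    unfolding X_def sum_product
    using int E2 by (simp add: Bochner_Integration.integral_sum)
  \<comment> \<open>Disjoint pairs contribute the ratio 1. Granting this 1 to overlapping pairs as
    well only enlarges the sum and makes its first part exactly mu^2.\<close>
  also have "\<dots> \<le> (\<Sum>\<phi>\<in>?\<Phi>. \<Sum>\<psi>\<in>?\<Phi>. p ^ (2 * card E) * (1 + (if ?c \<phi> \<inter> ?c \<psi> = {} then 0
      else 1 / p ^ card (?c \<phi> \<inter> ?c \<psi>))))"
    using p by (intro sum_mono) (simp add: distrib_left)
  also have "\<dots> = (\<Sum>\<phi>\<in>?\<Phi>. p ^ (2 * card E) * (N + (\<Sum>\<psi>\<in>?\<Phi>. if ?c \<phi> \<inter> ?c \<psi> = {} then 0
      else 1 / p ^ card (?c \<phi> \<inter> ?c \<psi>))))"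
    by (simp add: sum_distrib_left[symmetric] sum.distrib N_def)
  also have "\<dots> \<le> (\<Sum>\<phi>\<in>?\<Phi>. p ^ (2 * card E) * (N + overlap_sum p))"
    using p by (intro sum_mono mult_left_mono add_left_mono sum_overlaps_le) auto
  also have "\<dots> = \<mu>\<^sup>2 + \<mu>\<^sup>2 * (overlap_sum p / N)"
  proof -
    have "p ^ (2 * card E) = p ^ card E * p ^ card E" by (simp add: mult_2 power_add)
    then show ?thesis
      using N by (simp add: N_def[symmetric] \<mu>_def power2_eq_square field_simps)
  qed
  finally have EX2: "measure_pmf.expectation ?M (\<lambda>G. X G * X G) \<le> \<mu>\<^sup>2 + \<mu>\<^sup>2 * (overlap_sum p / N)" .
  let ?Z = "{G. \<forall>\<phi>\<in>?\<Phi>. \<not> ?c \<phi> \<subseteq> G}"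
  have "\<mu>\<^sup>2 * measure_pmf.prob ?M ?Z = measure_pmf.expectation ?M (\<lambda>G. \<mu>\<^sup>2 * indicator ?Z G)"
    by simp
  also have "\<dots> \<le> measure_pmf.expectation ?M (\<lambda>G. X G * X G - 2 * \<mu> * X G + \<mu>\<^sup>2)"
  proof (intro integral_mono int)
    fix G
    have "X G = 0" if "G \<in> ?Z" using that by (auto simp: X_def)
    moreover have "0 \<le> (X G - \<mu>)\<^sup>2" by simp
    then have "0 \<le> X G * X G - 2 * \<mu> * X G + \<mu>\<^sup>2" by (simp add: power2_eq_square algebra_simps)
    ultimately show "\<mu>\<^sup>2 * indicator ?Z G \<le> X G * X G - 2 * \<mu> * X G + \<mu>\<^sup>2"
      by (simp add: indicator_def)
  qed
  also have "\<dots> = measure_pmf.expectation ?M (\<lambda>G. X G * X G) - 2 * \<mu> * \<mu> + \<mu>\<^sup>2"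
    using int by (simp add: EX)
  also have "\<dots> \<le> \<mu>\<^sup>2 * (overlap_sum p / N)" using EX2 by (simp add: power2_eq_square)
  finally have "\<mu>\<^sup>2 * measure_pmf.prob ?M ?Z \<le> \<mu>\<^sup>2 * (overlap_sum p / N)" .
  moreover have "0 < \<mu>\<^sup>2" using \<mu> by simp
  ultimately show ?thesis unfolding N_def[symmetric] by (rule mult_left_le_imp_le)
qed

end

end

subsection \<open>The lower bound on the percolation probability\<close>

lemma tree_edge_not_in_roots:
  assumes r: "r \<ge> 4" and t: "t \<ge> 1" and q: "q \<in> paths r t"
  shows "\<not> tree_edge q \<subseteq> roots"
proof
  assume "tree_edge q \<subseteq> roots"
  then have "tree_span {q} - roots = {}" by (simp add: tree_span_def)
  with tree_balanced[OF r, of "{q}" t] q have "1 \<le> 1 / tau r ^ t" by simp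
  moreover have "tau r \<le> tau r ^ t" using tau_ge_5[OF r] t by (intro self_le_power) auto
  ultimately show False using tau_ge_5[OF r] by (simp add: field_simps)
qed

lemma rooted_graph_tree:
  assumes r: "r \<ge> 4" and t: "t \<ge> 1"
  shows "rooted_graph (paths r t) tree_edge (inner_vertices r t) roots"
proof
  show "inner_vertices r t \<inter> roots = {}" using roots_disjoint_inner by blast
  show "inj_on tree_edge (paths r t)" by (rule inj_on_tree_edge[OF r])
  show "card (tree_edge q) = 2" if "q \<in> paths r t" for q
    using that card_tree_edge by (auto simp: paths_def)
qed (simp_all add: tree_edge_subset tree_edge_not_in_roots[OF r t])

text \<open>Proper overlaps, at most 2^m of them, gain n^(-1/(slope m)) by strict balancedness. The
  overlap in all edges is critical and keeps only the factor (1/ln n)^m from the logarithm in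
  \<open>p\<close>. The prefactor pays for the \<open>v\<close> choices per overlapped vertex, for
  the ratio n/N, and for the factor 2 per vertex lost in counting injective maps.\<close>

lemma prob_no_tree_copy_le:
  fixes r t n N :: nat and p :: real
  assumes r: "r \<ge> 4" and t: "t \<ge> 1" and n: "n \<ge> 3" and p: "0 < p" "p \<le> 1"
  defines "m \<equiv> ((r choose 2) - 1) ^ t" and "v \<equiv> new_vertices r t"
  assumes p_ge: "real n powr (- ((1 - 1 / real m) / slope r)) * ln (real n) \<le> p"
    and S: "S \<subseteq> {1..n}" "card S = N" "2 * v \<le> N" "N > 0"
    and \<rho>: "inj_on \<rho> roots" "\<rho> ` roots \<subseteq> {1..n} - S"
  shows "measure_pmf.prob (random_graph n p)
      {G. \<forall>\<phi>\<in>rooted_graph.embeddings (inner_vertices r t) S.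
        \<not> rooted_graph.copy (paths r t) tree_edge roots \<rho> \<phi> \<subseteq> G} \<le>
    (2 * real v * (real n / real N)) ^ v *
      (2 ^ m * real n powr (- (1 / (slope r * real m))) + (1 / ln (real n)) ^ m)"
proof -
  interpret rooted_graph "paths r t" tree_edge "inner_vertices r t" roots
    by (rule rooted_graph_tree[OF r t])
  have a2: "slope r \<ge> 2" by (rule slope_ge_2[OF r])
  have cV: "card (inner_vertices r t) = v" by (simp add: card_inner_vertices[OF r] v_def)
  have cE: "card (paths r t) = m" by (simp add: card_paths[OF r] m_def)
  have finS: "finite S" using S finite_subset by blast
  have m_real: "real m = tau r ^ t" using real_tau[OF r] by (simp add: m_def)
  have m_pos: "m > 0" using m_real tau_ge_5[OF r] by (metis of_nat_0_less_iff zero_less_power less_le_trans zero_less_numeral)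
  have v_eq: "real v = (real m - 1) / slope r" by (simp add: v_def m_real new_vertices_eq[OF r])
  have L: "ln (real n) \<ge> 1"
  proof -
    have "exp 1 \<le> real n" using exp_le n by linarith
    then show ?thesis using n by (subst ln_ge_iff) auto
  qed
  have "N \<le> n" using S card_mono[of "{1..n}" S] by simp
  then have B1: "real n / real N \<ge> 1" using S by simp
  have v1: "v \<ge> 1" if "D \<subseteq> paths r t" "D \<noteq> {}" for D
  proof -
    have "\<exists>q. q \<in> paths r t" using that by blast
    then have "inner_vertices r t \<noteq> {}"
      using tree_edge_not_in_roots[OF r t] tree_edge_subset by blast
    then have "card (inner_vertices r t) > 0" by (simp add: card_gt_0_iff)
    then show ?thesis using cV by simp
  qed
  let ?c = "real n powr (- (1 / (slope r * real m)))"
  let ?b = "(1 - 1 / real m) / slope r"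
  have inv_p: "1 / p ^ k \<le> real n powr (?b * real k) * (1 / ln (real n)) ^ k" for k
  proof -
    have "0 < real n powr (- ?b) * ln (real n)" using n L by simp
    then have "1 / p \<le> 1 / (real n powr (- ?b) * ln (real n))"
      using p_ge by (intro divide_left_mono) (auto intro: mult_pos_pos p)
    also have "\<dots> = real n powr ?b * (1 / ln (real n))" by (simp add: powr_minus field_simps)
    finally have "(1 / p) ^ k \<le> (real n powr ?b * (1 / ln (real n))) ^ k"
      using p by (intro power_mono) auto
    also have "\<dots> = real n powr (?b * real k) * (1 / ln (real n)) ^ k"
      using n by (subst power_mult_distrib, subst powr_power) (auto simp: mult.commute)
    finally show ?thesis by (simp add: power_one_over)
  qed
  define J where "J D = card (\<Union>(tree_edge ` D) - roots)" for D
  have J_le: "J D \<le> v" if "D \<subseteq> paths r t" for D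
    unfolding J_def cV[symmetric]
    by (rule card_mono) (use tree_span_subset[OF that] in \<open>auto simp: tree_span_def\<close>)
  have term_le: "real (v ^ J D * N ^ (v - J D)) / p ^ card D \<le>
      real N ^ v * (real v * (real n / real N)) ^ v * (real n powr (?b * real (card D) - real (J D)) * (1 / ln (real n)) ^ card D)"
    if D: "D \<subseteq> paths r t" "D \<noteq> {}" for D
  proof -
    have "real (v ^ J D * N ^ (v - J D)) / p ^ card D =
        real N ^ v * (real v / real N) ^ J D * (1 / p ^ card D)"
    proof -
      have "real N ^ (v - J D) = real N ^ v / real N ^ J D"
        using S(4) J_le[OF D(1)] by (intro power_diff) auto
      then show ?thesis by (simp add: power_divide)
    qed
    also have "\<dots> \<le> real N ^ v * (real v / real N) ^ J D *
        (real n powr (?b * real (card D)) * (1 / ln (real n)) ^ card D)"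
      using inv_p by (intro mult_left_mono) auto
    also have "(real v / real N) ^ J D = (real v * (real n / real N)) ^ J D * real n powr (- real (J D))"
      using n by (simp add: powr_minus powr_realpow power_divide power_mult_distrib field_simps)
    also have "real N ^ v * ((real v * (real n / real N)) ^ J D * real n powr (- real (J D))) *
        (real n powr (?b * real (card D)) * (1 / ln (real n)) ^ card D) =
        real N ^ v * (real v * (real n / real N)) ^ J D *
        (real n powr (?b * real (card D) - real (J D)) * (1 / ln (real n)) ^ card D)"
      by (simp add: powr_diff powr_minus field_simps)
    also have "\<dots> \<le> real N ^ v * (real v * (real n / real N)) ^ v *
        (real n powr (?b * real (card D) - real (J D)) * (1 / ln (real n)) ^ card D)"
    proof -
      \<comment> \<open>With a base of at least 1, the exponent \<open>J D\<close> may be raised to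
        \<open>v\<close>, which makes the prefactor independent of \<open>D\<close>.\<close>
      have "1 * 1 \<le> real v * (real n / real N)"
        using v1[OF D] B1 by (intro mult_mono) auto
      then have "(real v * (real n / real N)) ^ J D \<le> (real v * (real n / real N)) ^ v"
        using J_le[OF D(1)] by (intro power_increasing) auto
      then show ?thesis using L by (intro mult_right_mono mult_left_mono) auto
    qed
    finally show ?thesis .
  qed
  let ?B = "real N ^ v * (real v * (real n / real N)) ^ v"
  have proper: "real (v ^ J D * N ^ (v - J D)) / p ^ card D \<le> ?B * ?c"
    if D: "D \<subseteq> paths r t" "D \<noteq> {}" "D \<noteq> paths r t" for D
  proof -
    have "real (card D) + 1 / real m \<le> slope r * real (J D) + real (card D) / real m"
      using tree_strictly_balanced[OF r D(1) t D(2,3)] by (simp add: J_def tree_span_def m_real)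
    then have "(1 - 1 / real m) * real (card D) / slope r \<le> (slope r * real (J D) - 1 / real m) / slope r"
      using a2 by (intro divide_right_mono) (auto simp: algebra_simps)
    then have ex: "?b * real (card D) - real (J D) \<le> - (1 / (slope r * real m))"
    proof -
      assume "(1 - 1 / real m) * real (card D) / slope r \<le> (slope r * real (J D) - 1 / real m) / slope r"
      moreover have "(slope r * real (J D) - 1 / real m) / slope r = real (J D) - 1 / (slope r * real m)"
        using a2 by (simp add: diff_divide_distrib mult.commute)
      moreover have "?b * real (card D) = (1 - 1 / real m) * real (card D) / slope r" by simp
      ultimately show ?thesis by linarith
    qed
    have "real n powr (?b * real (card D) - real (J D)) * (1 / ln (real n)) ^ card D \<le> ?c * 1"
      using ex n L by (intro mult_mono powr_mono power_le_one) auto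
    then have "?B * (real n powr (?b * real (card D) - real (J D)) * (1 / ln (real n)) ^ card D) \<le> ?B * ?c"
      by (intro mult_left_mono) auto
    with term_le[OF D(1,2)] show ?thesis by linarith
  qed
  have full: "real (v ^ J D * N ^ (v - J D)) / p ^ card D \<le> ?B * (1 / ln (real n)) ^ m"
    if D: "D = paths r t" "D \<noteq> {}" for D
  proof -
    have "real (card D) \<le> slope r * real (J D) + real (card D) / real m"
      using tree_balanced[OF r, of D t] D by (simp add: J_def tree_span_def m_real)
    then have "(1 - 1 / real m) * real (card D) / slope r \<le> slope r * real (J D) / slope r"
      using a2 by (intro divide_right_mono) (auto simp: algebra_simps)
    then have ex: "?b * real (card D) - real (J D) \<le> 0"
      using a2 by (simp add: mult.commute)
    have "real n powr (?b * real (card D) - real (J D)) \<le> real n powr 0"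
      using ex n by (intro powr_mono) auto
    then have "real n powr (?b * real (card D) - real (J D)) * (1 / ln (real n)) ^ card D \<le>
        1 * (1 / ln (real n)) ^ m"
      using n L D cE by (intro mult_mono) auto
    then have "?B * (real n powr (?b * real (card D) - real (J D)) * (1 / ln (real n)) ^ card D) \<le>
        ?B * (1 / ln (real n)) ^ m"
      by (intro mult_left_mono) auto
    with term_le[of D] D show ?thesis by simp
  qed
  have emb: "(real N / 2) ^ v \<le> real (card (embeddings S))"
    using card_embeddings_ge[OF finS] S cV by simp
  have emb_pos: "0 < (real N / 2) ^ v" using S by simp
  then have ne: "embeddings S \<noteq> {}" using emb by auto
  have nonempty: "paths r t \<noteq> {}" using cE m_pos by auto
  have "overlap_sum S p \<le> ?B * (2 ^ m * ?c + (1 / ln (real n)) ^ m)"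
  proof -
    have "overlap_sum S p = (\<Sum>D\<in>Pow (paths r t) - {{}}. real (v ^ J D * N ^ (v - J D)) / p ^ card D)"
      unfolding overlap_sum_def[OF \<rho>(1) S(1) \<rho>(2)] by (simp add: J_def cV S)
    also have "Pow (paths r t) - {{}} = insert (paths r t) (Pow (paths r t) - {{}, paths r t})"
      using nonempty by auto
    also have "(\<Sum>D\<in>\<dots>. real (v ^ J D * N ^ (v - J D)) / p ^ card D) =
        real (v ^ J (paths r t) * N ^ (v - J (paths r t))) / p ^ card (paths r t) +
        (\<Sum>D\<in>Pow (paths r t) - {{}, paths r t}. real (v ^ J D * N ^ (v - J D)) / p ^ card D)"
      by (subst sum.insert) auto
    also have "\<dots> \<le> ?B * (1 / ln (real n)) ^ m + (\<Sum>D\<in>Pow (paths r t) - {{}, paths r t}. ?B * ?c)"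
      using nonempty by (intro add_mono full sum_mono proper) auto
    also have "(\<Sum>D\<in>Pow (paths r t) - {{}, paths r t}. ?B * ?c) \<le> (\<Sum>D\<in>Pow (paths r t). ?B * ?c)"
      by (intro sum_mono2) auto
    also have "\<dots> = 2 ^ m * (?B * ?c)" by (simp add: card_Pow cE)
    finally show ?thesis by (simp add: algebra_simps)
  qed
  then have "overlap_sum S p / real (card (embeddings S)) \<le>
      ?B * (2 ^ m * ?c + (1 / ln (real n)) ^ m) / (real N / 2) ^ v"
    using emb emb_pos L by (intro frac_le) (auto intro!: mult_nonneg_nonneg add_nonneg_nonneg)
  also have "\<dots> = (2 * real v * (real n / real N)) ^ v * (2 ^ m * ?c + (1 / ln (real n)) ^ m)"
    using S by (simp add: power_divide power_mult_distrib field_simps)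
  finally show ?thesis
    using prob_no_copy_le[OF \<rho>(1) S(1) \<rho>(2) p ne] by linarith
qed

section \<open>Independent attempts in disjoint vertex sets\<close>

lemma exists_disjoint_parts:
  assumes "finite A" "k * N \<le> card A"
  shows "\<exists>S :: nat \<Rightarrow> 'a set. disjoint_family_on S {..<k} \<and> (\<forall>i<k. S i \<subseteq> A \<and> card (S i) = N)"
  using assms
proof (induction k arbitrary: A)
  case 0
  then show ?case by (simp add: disjoint_family_on_def)
next
  case (Suc k)
  then have "N \<le> card A" by simp
  then obtain T where T: "T \<subseteq> A" "card T = N" "finite T"
    by (rule obtain_subset_with_card_n)
  have "k * N \<le> card (A - T)" using Suc.prems T by (simp add: card_Diff_subset)
  then obtain S :: "nat \<Rightarrow> 'a set" where S: "disjoint_family_on S {..<k}"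
      "\<And>i. i < k \<Longrightarrow> S i \<subseteq> A - T \<and> card (S i) = N"
    using Suc.IH[of "A - T"] Suc.prems by auto
  have "disjoint_family_on (S(k := T)) {..<Suc k}"
    unfolding disjoint_family_on_def
  proof (intro ballI impI)
    fix i j assume ij: "i \<in> {..<Suc k}" "j \<in> {..<Suc k}" "i \<noteq> j"
    then consider "i < k" "j < k" | "i = k" "j < k" | "i < k" "j = k" by fastforce
    then show "(S(k := T)) i \<inter> (S(k := T)) j = {}"
    proof cases
      case 1
      then show ?thesis using S(1) ij by (auto simp: disjoint_family_on_def)
    qed (use S(2) in auto)
  qed
  moreover have "\<forall>i<Suc k. (S(k := T)) i \<subseteq> A \<and> card ((S(k := T)) i) = N"
    using S(2) T by (auto simp: less_Suc_eq)
  ultimately show ?case by blast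
qed

text \<open>The sets \<open>S i\<close>, each enlarged by the ends of \<open>e\<close>, share no
  vertex pair but \<open>e\<close> itself, and copies avoid \<open>e\<close>. The attempts therefore
  depend on disjoint edge sets, and their failure probabilities multiply.\<close>

lemma prob_edge_missing_le:
  fixes r t n N k :: nat and p b :: real
  assumes r: "r \<ge> 4" and t: "t \<ge> 1" and n: "n \<ge> 3" and p: "0 < p" "p \<le> 1"
  defines "m \<equiv> ((r choose 2) - 1) ^ t" and "v \<equiv> new_vertices r t"
  assumes p_ge: "real n powr (- ((1 - 1 / real m) / slope r)) * ln (real n) \<le> p"
    and N: "2 * v \<le> N" "N > 0" "k * N \<le> n - 2"
    and b: "(2 * real v * (real n / real N)) ^ v *
      (2 ^ m * real n powr (- (1 / (slope r * real m))) + (1 / ln (real n)) ^ m) \<le> b"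
    and e: "e \<in> K n"
  shows "measure_pmf.prob (random_graph n p) {G. e \<notin> bootstrap n r G t} \<le> b ^ k"
proof -
  interpret rooted_graph "paths r t" tree_edge "inner_vertices r t" roots
    by (rule rooted_graph_tree[OF r t])
  obtain x y where xy: "e = {x, y}" "x \<noteq> y" "x \<in> {1..n}" "y \<in> {1..n}"
    using e by (auto simp: complete_graph_def card_2_iff)
  have "card ({1..n} - e) = n - 2" using xy by (subst card_Diff_subset) auto
  then obtain S where S: "disjoint_family_on S {..<k}"
      "\<And>i. i < k \<Longrightarrow> S i \<subseteq> {1..n} - e \<and> card (S i) = N"
    using exists_disjoint_parts[of "{1..n} - e" k N] N by auto
  define \<rho> where "\<rho> v = (if v = ([], 0) then x else y)" for v :: tree_vertex
  have \<rho>_roots: "\<rho> ` roots = e" using xy by (auto simp: \<rho>_def roots_def)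
  have inj: "inj_on \<rho> roots" using xy by (auto simp: \<rho>_def roots_def inj_on_def)
  have \<rho>: "\<rho> ` roots \<subseteq> {1..n} - S i" and Si: "S i \<subseteq> {1..n}" if "i < k" for i
    using S(2)[OF that] xy \<rho>_roots by auto
  define P where "P i G \<longleftrightarrow> (\<forall>\<phi>\<in>embeddings (S i). \<not> copy \<rho> \<phi> \<subseteq> G)" for i G
  define F where "F i = complete_graph (S i \<union> e) - {e}" for i
  have "P i G" if i: "i < k" and G: "e \<notin> bootstrap n r G t" for i G
    unfolding P_def
  proof (intro ballI notI)
    fix \<phi> assume \<phi>: "\<phi> \<in> embeddings (S i)" "copy \<rho> \<phi> \<subseteq> G"
    have "extend \<rho> \<phi> ` roots \<in> bootstrap n r G t"
    proof (rule bootstrap_tree_copy[OF r])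
      show "inj_on (extend \<rho> \<phi>) (inner_vertices r t \<union> roots)"
        by (rule inj_extend[OF inj Si[OF i] \<rho>[OF i] \<phi>(1)])
      show "extend \<rho> \<phi> ` (inner_vertices r t \<union> roots) \<subseteq> {1..n}"
        using extend_in[OF inj Si[OF i] \<rho>[OF i] \<phi>(1)] Si[OF i] \<rho>[OF i] by blast
      show "extend \<rho> \<phi> ` tree_edge q \<in> G" if "q \<in> paths r t" for q
        using \<phi>(2) that by (auto simp: copy_def)
    qed
    moreover have "extend \<rho> \<phi> ` roots = e" unfolding \<rho>_roots[symmetric] by (simp add: extend_def)
    ultimately show False using G by simp
  qed
  then have "measure_pmf.prob (random_graph n p) {G. e \<notin> bootstrap n r G t} \<le>
      measure_pmf.prob (random_graph n p) {G. \<forall>i\<in>{..<k}. P i G}"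
    by (intro measure_pmf.finite_measure_mono) auto
  also have "\<dots> = (\<Prod>i<k. measure_pmf.prob (random_graph n p) {G. P i G})"
  proof (rule prob_disjoint_edge_sets[where E = F])
    show "disjoint_family_on F {..<k}"
      unfolding disjoint_family_on_def
    proof (intro ballI impI)
      fix i j assume ij: "i \<in> {..<k}" "j \<in> {..<k}" "i \<noteq> j"
      then have "(S i \<union> e) \<inter> (S j \<union> e) = e" using S(1) by (auto simp: disjoint_family_on_def)
      moreover have "f = e" if "f \<subseteq> e" "card f = 2" for f
        using that xy by (intro card_subset_eq) auto
      ultimately show "F i \<inter> F j = {}" unfolding F_def complete_graph_def by blast
    qed
    show "P i G = P i (G \<inter> F i)" if "i \<in> {..<k}" for i G
    proof -
      have "copy \<rho> \<phi> \<subseteq> F i" if "\<phi> \<in> embeddings (S i)" for \<phi>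
        using copy_subset[OF inj Si \<rho> that] \<open>i \<in> {..<k}\<close> by (simp add: F_def \<rho>_roots)
      then show ?thesis unfolding P_def by blast
    qed
  qed simp
  also have "\<dots> \<le> (\<Prod>i<k. b)"
  proof (rule prod_mono)
    fix i assume "i \<in> {..<k}"
    then have i: "i < k" by simp
    have "measure_pmf.prob (random_graph n p) {G. P i G} \<le> b"
      unfolding P_def
      using prob_no_tree_copy_le[OF r t n p p_ge[unfolded m_def] Si[OF i] _ _ N(2) inj \<rho>[OF i]]
        S(2)[OF i] N(1) b unfolding m_def v_def by (meson order_trans)
    then show "0 \<le> measure_pmf.prob (random_graph n p) {G. P i G} \<and>
        measure_pmf.prob (random_graph n p) {G. P i G} \<le> b" by simp
  qed
  finally show ?thesis by simp
qed

lemma prob_percolation_ge: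
  fixes r t n N k :: nat and p b :: real
  assumes "r \<ge> 4" "t \<ge> 1" "n \<ge> 3" "0 < p" "p \<le> 1"
  defines "m \<equiv> ((r choose 2) - 1) ^ t" and "v \<equiv> new_vertices r t"
  assumes "real n powr (- ((1 - 1 / real m) / slope r)) * ln (real n) \<le> p"
    and "2 * v \<le> N" "N > 0" "k * N \<le> n - 2"
    and "(2 * real v * (real n / real N)) ^ v *
      (2 ^ m * real n powr (- (1 / (slope r * real m))) + (1 / ln (real n)) ^ m) \<le> b"
  shows "1 - real n ^ 2 * b ^ k \<le>
    measure_pmf.prob (random_graph n p) {G. percolation_time n r G \<le> enat t}"
proof -
  let ?M = "random_graph n p"
  have b: "0 \<le> b"
    by (rule order_trans[OF _ assms(12)]) (use assms(3) in auto)
  have "1 - measure_pmf.prob ?M {G. percolation_time n r G \<le> enat t} =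
      measure_pmf.prob ?M (- {G. percolation_time n r G \<le> enat t})"
    using measure_pmf.prob_compl[of "{G. percolation_time n r G \<le> enat t}" ?M] by (simp add: Compl_eq_Diff_UNIV)
  also have "\<dots> \<le> measure_pmf.prob ?M (\<Union>e\<in>K n. {G. e \<notin> bootstrap n r G t})"
  proof (rule measure_pmf.finite_measure_mono_AE)
    have "G \<in> (\<Union>e\<in>K n. {G. e \<notin> bootstrap n r G t})"
      if "G \<subseteq> K n" "\<not> percolation_time n r G \<le> enat t" for G
      using that percolation_time_le_iff[of G n r t] bootstrap_subset_K[of G n r t] by blast
    then show "AE G in ?M. G \<in> - {G. percolation_time n r G \<le> enat t} \<longrightarrow>
        G \<in> (\<Union>e\<in>K n. {G. e \<notin> bootstrap n r G t})"
      using set_pmf_random_graph by (auto simp: AE_measure_pmf_iff)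
  qed simp
  also have "\<dots> \<le> (\<Sum>e\<in>K n. measure_pmf.prob ?M {G. e \<notin> bootstrap n r G t})"
    by (intro measure_UNION_le) auto
  also have "\<dots> \<le> (\<Sum>e\<in>K n. b ^ k)"
    by (intro sum_mono prob_edge_missing_le) (use assms in auto)
  also have "\<dots> \<le> real n ^ 2 * b ^ k"
  proof -
    have "card (K n) \<le> n ^ 2"
      using assms(3) by (simp add: card_complete_graph binomial_le_pow)
    then have "real (card (K n)) \<le> real n ^ 2" by (metis of_nat_le_iff of_nat_power)
    then show ?thesis using b by (simp add: mult_right_mono)
  qed
  finally show ?thesis by simp
qed

subsection \<open>Asymptotics\<close>

lemma exponent_eq:
  assumes "r \<ge> 4"
  shows "(v_num r t - 2) / e_num r t = (1 - 1 / real (((r choose 2) - 1) ^ t)) / slope r"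
proof -
  have m: "real (((r choose 2) - 1) ^ t) = tau r ^ t" using real_tau[OF assms] by simp
  show ?thesis
    unfolding m using tau_ge_5[OF assms] assms
    by (simp add: v_num_def e_num_def slope_def field_simps)
qed

lemma eventually_admissible: "eventually (admissible r) sequentially"
proof -
  have "filterlim (\<lambda>n. ln (ln (real n))) at_top sequentially" by real_asymp
  then show ?thesis unfolding filterlim_at_top admissible_def[abs_def] by blast
qed

text \<open>The factor 3 in the range of \<open>t\<close> becomes the exponent 1/3. It makes m^2 ln
  ln n negligible against ln n, as the exponential estimates in both limits require.\<close>

lemma edges_le_cube_root:
  assumes r: "r \<ge> 4" and t: "1 \<le> t" "real t \<le> ln (ln (real n)) / (3 * ln (tau r))"
    and n: "ln (real n) > 0"
  defines "m \<equiv> ((r choose 2) - 1) ^ t"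
  shows "5 \<le> m" and "real m \<le> ln (real n) powr (1 / 3)"
proof -
  have tau: "tau r \<ge> 5" by (rule tau_ge_5[OF r])
  have m: "real m = tau r ^ t" using real_tau[OF r] by (simp add: m_def)
  have "tau r \<le> tau r ^ t" using tau t by (intro self_le_power) auto
  with tau m show "5 \<le> m" by linarith
  have "real t * ln (tau r) \<le> ln (ln (real n)) / 3"
    using t tau by (simp add: field_simps)
  then have "exp (real t * ln (tau r)) \<le> exp (ln (ln (real n)) / 3)" by simp
  moreover have "exp (real t * ln (tau r)) = tau r ^ t" using tau by (simp add: exp_of_nat_mult)
  moreover have "exp (ln (ln (real n)) / 3) = ln (real n) powr (1 / 3)"
    using n by (simp add: powr_def)
  ultimately show "real m \<le> ln (real n) powr (1 / 3)" using m by simp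
qed

lemma powr_eq_exp: "n > 0 \<Longrightarrow> real n powr a = exp (a * ln (real n))"
  by (simp add: powr_def)

lemma nat_power_eq_exp: "0 < x \<Longrightarrow> x ^ k = exp (real k * ln x)" for x :: real
  by (simp add: exp_of_nat_mult)

lemma prob_percolation_tendsto_0:
  fixes r :: nat and t :: "nat \<Rightarrow> nat" and p \<omega> :: "nat \<Rightarrow> real"
  assumes r: "r \<ge> 4"
    and t: "\<And>n. admissible r n \<Longrightarrow>
           1 \<le> t n \<and> real (t n) \<le> ln (ln (real n)) / (3 * ln (tau r))"
    and p: "\<And>n. 0 \<le> p n \<and> p n \<le> 1"
    and \<omega>: "filterlim \<omega> at_top sequentially"
    and p_le: "\<And>n. admissible r n \<Longrightarrow>
         p n \<le> real n powr (- ((v_num r (t n) - 2) / e_num r (t n))) / \<omega> n"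
  shows "(\<lambda>n. measure_pmf.prob (random_graph n (p n)) {G. percolation_time n r G \<le> enat (t n)})
        \<longlonglongrightarrow> 0"
proof -
  define a where "a = slope r"
  have a: "a > 0" using slope_ge_2[OF r] by (simp add: a_def)
  \<comment> \<open>The dense-pair bound with \<open>m\<close> replaced by its largest possible
    value (ln n)^(1/3); both parts of the exponent increase with \<open>m\<close>.\<close>
  define g where "g n = exp ((2 * (ln (real n) powr (1/3)) + 1) * ln (ln (real n) powr (1/3))
    - ln (real n) / (a * ln (real n) powr (1/3)))" for n :: nat
  have "g \<longlonglongrightarrow> 0" unfolding g_def using a by real_asymp
  moreover have "(\<lambda>n. 1 / \<omega> n) \<longlonglongrightarrow> 0"
    using \<omega> by (intro tendsto_divide_0[OF tendsto_const] filterlim_at_top_imp_at_infinity)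
  ultimately have lim: "(\<lambda>n. 1 / \<omega> n + g n) \<longlonglongrightarrow> 0"
    using tendsto_add[of "\<lambda>n. 1 / \<omega> n" 0 sequentially g 0] by simp
  have ev: "eventually (\<lambda>n. admissible r n \<and> ln (real n) > 0 \<and> \<omega> n \<ge> 1 \<and> n \<ge> 2) sequentially"
  proof (intro eventually_conj)
    show "eventually (\<lambda>n. ln (real n) > 0) sequentially" by real_asymp
    show "eventually (\<lambda>n. \<omega> n \<ge> 1) sequentially" using \<omega> by (simp add: filterlim_at_top)
  qed (auto simp: eventually_admissible eventually_ge_at_top)
  show ?thesis
  proof (rule tendsto_sandwich[OF _ _ tendsto_const lim])
    show "eventually (\<lambda>n. measure_pmf.prob (random_graph n (p n)) {G. percolation_time n r G \<le> enat (t n)}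
        \<le> 1 / \<omega> n + g n) sequentially"
      using ev
    proof eventually_elim
      case (elim n)
      define m where "m = ((r choose 2) - 1) ^ t n"
      have tn: "1 \<le> t n" "real (t n) \<le> ln (ln (real n)) / (3 * ln (tau r))" using t elim by auto
      have m5: "5 \<le> m" and m_le: "real m \<le> ln (real n) powr (1 / 3)"
        using edges_le_cube_root[OF r tn] elim unfolding m_def by auto
      have "p n \<le> real n powr (- ((1 - 1 / real m) / slope r)) / \<omega> n"
        using p_le elim by (simp add: exponent_eq[OF r] m_def)
      then have "measure_pmf.prob (random_graph n (p n)) {G. percolation_time n r G \<le> enat (t n)} \<le>
          1 / \<omega> n + real m * real (m ^ (2 * m)) * real n powr (- (1 / (slope r * real m)))"
        unfolding m_def using elim p tn r by (intro prob_percolation_le) auto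
      also have "real m * real (m ^ (2 * m)) * real n powr (- (1 / (slope r * real m))) =
          exp ((2 * real m + 1) * ln (real m) - ln (real n) / (a * real m))"
      proof -
        have "real m * real (m ^ (2 * m)) = real m ^ (2 * m + 1)" by simp
        also have "\<dots> = exp (real (2 * m + 1) * ln (real m))"
          using m5 by (intro nat_power_eq_exp) auto
        finally have 1: "real m * real (m ^ (2 * m)) = exp ((2 * real m + 1) * ln (real m))" by simp
        have 2: "real n powr (- (1 / (slope r * real m))) = exp (- (ln (real n) / (a * real m)))"
          using elim by (simp add: powr_eq_exp a_def)
        show ?thesis unfolding 1 2 exp_add[symmetric] by simp
      qed
      also have "\<dots> \<le> g n"
      proof -
        have "ln (real m) \<le> ln (ln (real n) powr (1/3))"
          using m5 m_le by (intro ln_mono) auto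
        then have "(2 * real m + 1) * ln (real m) \<le>
            (2 * (ln (real n) powr (1/3)) + 1) * ln (ln (real n) powr (1/3))"
          using m5 m_le by (intro mult_mono) (auto simp del: ln_powr)
        moreover have "ln (real n) / (a * ln (real n) powr (1/3)) \<le> ln (real n) / (a * real m)"
          using m5 m_le a elim by (intro divide_left_mono mult_left_mono mult_pos_pos) auto
        ultimately show ?thesis unfolding g_def by simp
      qed
      finally show ?case by simp
    qed
  qed simp
qed

lemma prob_percolation_tendsto_1:
  fixes r :: nat and t :: "nat \<Rightarrow> nat" and p :: "nat \<Rightarrow> real"
  assumes r: "r \<ge> 4"
    and t: "\<And>n. admissible r n \<Longrightarrow>
           1 \<le> t n \<and> real (t n) \<le> ln (ln (real n)) / (3 * ln (tau r))"
    and p: "\<And>n. 0 \<le> p n \<and> p n \<le> 1"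
    and p_ge: "\<And>n. admissible r n \<Longrightarrow>
         p n \<ge> real n powr (- ((v_num r (t n) - 2) / e_num r (t n))) * ln (real n)"
  shows "(\<lambda>n. measure_pmf.prob (random_graph n (p n)) {G. percolation_time n r G \<le> enat (t n)})
        \<longlonglongrightarrow> 1"
proof -
  define a where "a = slope r"
  have a: "a \<ge> 2" "a > 0" using slope_ge_2[OF r] by (auto simp: a_def)
  define L where "L n = ln (real n)" for n :: nat
  define x where "x n = L n powr (1/3)" for n
  \<comment> \<open>Failure bound for one attempt: the exponential covers proper overlaps, the last
    summand the total overlap. The quantity \<open>8 * x n * L n\<close> dominates 2v(n/N), as 2v <=
    m <= \<open>x n\<close> and n/N <= \<open>8 * L n\<close>.\<close>
  define h where "h n = exp (x n * ln (8 * x n * L n) + x n * ln 2 - L n / (a * x n)) + 8 * x n / L n" for n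
  have "h \<longlonglongrightarrow> 0" unfolding h_def x_def L_def using a(2) by real_asymp
  then have ev_h: "eventually (\<lambda>n. h n \<le> exp (- 1)) sequentially"
    by (rule order_tendstoD(2)[THEN eventually_mono, of h 0 sequentially "exp (- 1)"]) auto
  have ev: "eventually (\<lambda>n. admissible r n \<and> h n \<le> exp (- 1) \<and> n \<ge> 3 \<and> L n \<ge> 1 \<and> 8 * x n \<le> L n \<and>
      x n \<le> real n / (8 * L n) \<and> real n / (8 * L n) \<le> (real n - 2) / (3 * L n + 1) - 1) sequentially"
  proof (intro eventually_conj ev_h eventually_admissible)
    show "eventually (\<lambda>n. L n \<ge> 1) sequentially" unfolding L_def by real_asymp
    show "eventually (\<lambda>n. 8 * x n \<le> L n) sequentially" unfolding x_def L_def by real_asymp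
    show "eventually (\<lambda>n. x n \<le> real n / (8 * L n)) sequentially" unfolding x_def L_def by real_asymp
    show "eventually (\<lambda>n. real n / (8 * L n) \<le> (real n - 2) / (3 * L n + 1) - 1) sequentially"
      unfolding L_def by real_asymp
  qed (auto simp: eventually_admissible eventually_ge_at_top)
  have lim: "(\<lambda>n. 1 - 1 / real n) \<longlonglongrightarrow> 1" by real_asymp
  show ?thesis
  proof (rule tendsto_sandwich[OF _ _ lim tendsto_const])
    show "eventually (\<lambda>n. 1 - 1 / real n \<le>
        measure_pmf.prob (random_graph n (p n)) {G. percolation_time n r G \<le> enat (t n)}) sequentially"
      using ev
    proof eventually_elim
      case (elim n)
      define m where "m = ((r choose 2) - 1) ^ t n"
      define v where "v = new_vertices r (t n)"
      \<comment> \<open>At least 3 ln n attempts, each failing with probability at most exp(-1),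
        leave n^(-3) per edge, enough against n^2 edges.\<close>
      define k where "k = nat \<lceil>3 * L n\<rceil>"
      define N where "N = (n - 2) div k"
      have L1: "L n \<ge> 1" and n3: "n \<ge> 3" using elim by auto
      have tn: "1 \<le> t n" "real (t n) \<le> ln (ln (real n)) / (3 * ln (tau r))" using t elim by auto
      have m5: "5 \<le> m" and m_le: "real m \<le> x n"
        using edges_le_cube_root[OF r tn] L1 unfolding m_def x_def L_def by auto
      have v_le: "2 * real v \<le> real m"
      proof -
        have "real v = (real m - 1) / a"
          using real_tau[OF r] by (simp add: v_def m_def a_def new_vertices_eq[OF r])
        also have "\<dots> \<le> (real m - 1) / 2" using a m5 by (intro divide_left_mono) auto
        finally show ?thesis by simp
      qed
      have k: "3 * L n \<le> real k" "real k \<le> 3 * L n + 1" "k > 0"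
        using L1 unfolding k_def by linarith+
      \<comment> \<open>The number of blocks is at most 3 \<open>L n\<close> + 1 <= 4
        \<open>L n\<close>; the further factor 2 absorbs the two root vertices and the rounding in
        \<open>div\<close>.\<close>
      have N_ge: "real n / (8 * L n) \<le> real N"
      proof -
        have "(real n - 2) / (3 * L n + 1) \<le> (real n - 2) / real k"
          using k n3 L1 by (intro divide_left_mono mult_pos_pos) auto
        also have "\<dots> = real (n - 2) / real k" using n3 by (simp add: of_nat_diff)
        also have "\<dots> \<le> real N + 1"
        proof -
          have "n - 2 \<le> (N + 1) * k"
            using dividend_less_times_div[OF k(3), of "n - 2"] by (simp add: N_def mult.commute)
          then have "real (n - 2) \<le> (real N + 1) * real k"
            by (metis of_nat_1 of_nat_add of_nat_le_iff of_nat_mult)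
          then show ?thesis using k(3) by (simp add: divide_le_eq)
        qed
        finally show ?thesis using elim by linarith
      qed
      have n8: "0 < real n / (8 * L n)" using n3 L1 by simp
      then have N: "N > 0" using N_ge by (metis gr0I less_le_trans of_nat_0 order_less_irrefl)
      have vN: "2 * v \<le> N"
      proof -
        have "2 * real v \<le> real N" using v_le m_le N_ge elim by linarith
        then show ?thesis by linarith
      qed
      have kN: "k * N \<le> n - 2" unfolding N_def by simp
      have nN: "real n / real N \<le> 8 * L n"
        using N_ge N L1 by (simp add: field_simps)
      have b: "(2 * real v * (real n / real N)) ^ v *
          (2 ^ m * real n powr (- (1 / (slope r * real m))) + (1 / ln (real n)) ^ m) \<le> exp (- 1)"
      proof -
        let ?y = "8 * x n * L n"
        have x1: "x n \<ge> 1" using m5 m_le by linarith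
        have y1: "?y \<ge> 1" using mult_mono[OF x1 L1] x1 L1 by simp
        have "(2 * real v * (real n / real N)) ^ v \<le> ?y ^ v"
        proof (rule power_mono)
          have "2 * real v * (real n / real N) \<le> x n * (8 * L n)"
            using v_le m_le nN x1 by (intro mult_mono) auto
          then show "2 * real v * (real n / real N) \<le> ?y" by (simp add: mult_ac)
        qed simp
        also have "?y ^ v = ?y powr real v" using y1 by (intro powr_realpow[symmetric]) linarith
        \<comment> \<open>A slope of at least 2 makes \<open>v\<close> at most m/2; this halving of
          the exponent decides the estimate of total overlap below.\<close>
        also have "\<dots> \<le> ?y powr (real m / 2)" using y1 v_le by (intro powr_mono) auto
        finally have pre: "(2 * real v * (real n / real N)) ^ v \<le> ?y powr (real m / 2)" .
        have first: "?y powr (real m / 2) * (2 ^ m * real n powr (- (1 / (slope r * real m)))) \<le>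
            exp (x n * ln ?y + x n * ln 2 - L n / (a * x n))"
        proof -
          have "?y powr (real m / 2) * (2 ^ m * real n powr (- (1 / (slope r * real m)))) =
              exp (real m / 2 * ln ?y) * (exp (real m * ln 2) * exp (- (L n / (a * real m))))"
            using y1 n3 x1 by (simp add: powr_def nat_power_eq_exp[of 2 m] L_def a_def)
          also have "\<dots> = exp (real m / 2 * ln ?y + real m * ln 2 - L n / (a * real m))"
            by (simp add: exp_add[symmetric])
          also have "\<dots> \<le> exp (x n * ln ?y + x n * ln 2 - L n / (a * x n))"
          proof -
            have "real m / 2 * ln ?y \<le> x n * ln ?y" using y1 m_le m5 by (intro mult_right_mono) auto
            moreover have "real m * ln 2 \<le> x n * ln 2" using m_le by (intro mult_right_mono) auto
            moreover have "L n / (a * x n) \<le> L n / (a * real m)"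
              using m5 m_le a L1 by (intro divide_left_mono mult_left_mono mult_pos_pos) auto
            ultimately show ?thesis unfolding exp_le_cancel_iff by linarith
          qed
          finally show ?thesis .
        qed
        have second: "?y powr (real m / 2) * (1 / ln (real n)) ^ m \<le> 8 * x n / L n"
        proof -
          \<comment> \<open>Written with the common exponent m/2, the gain is 1/L^2 per factor
            against a loss of 8xL, which leaves the base 8x/L tending to 0.\<close>
          have "(1 / ln (real n)) ^ m = ((1 / L n)\<^sup>2) powr (real m / 2)"
          proof -
            have "((1 / L n)\<^sup>2) powr (real m / 2) = ((1 / L n) powr 2) powr (real m / 2)"
              using L1 by simp
            also have "\<dots> = (1 / L n) powr real m" by (subst powr_powr) simp
            also have "\<dots> = (1 / L n) ^ m" using L1 by (intro powr_realpow) simp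
            finally show ?thesis by (simp add: L_def)
          qed
          then have "?y powr (real m / 2) * (1 / ln (real n)) ^ m = (?y * (1 / L n)\<^sup>2) powr (real m / 2)"
            using y1 L1 by (simp add: powr_mult)
          also have "?y * (1 / L n)\<^sup>2 = 8 * x n / L n" using L1 by (simp add: power2_eq_square)
          \<comment> \<open>The base is at most 1 and the exponent at least 1, so dropping the
            exponent gives a bound free of \<open>m\<close>.\<close>
          also have "(8 * x n / L n) powr (real m / 2) \<le> (8 * x n / L n) powr 1"
            using elim x1 L1 m5 by (intro powr_mono') auto
          also have "\<dots> = 8 * x n / L n" using x1 L1 by simp
          finally show ?thesis .
        qed
        have "(2 * real v * (real n / real N)) ^ v *
            (2 ^ m * real n powr (- (1 / (slope r * real m))) + (1 / ln (real n)) ^ m) \<le>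
            ?y powr (real m / 2) * (2 ^ m * real n powr (- (1 / (slope r * real m))) + (1 / ln (real n)) ^ m)"
          using pre L1 by (intro mult_right_mono) (auto simp: L_def)
        also have "\<dots> \<le> h n" using first second by (simp add: distrib_left h_def)
        finally show ?thesis using elim by linarith
      qed
      have p_ge': "real n powr (- ((1 - 1 / real m) / slope r)) * ln (real n) \<le> p n"
        using p_ge elim by (simp add: exponent_eq[OF r] m_def)
      have "0 < real n powr (- ((1 - 1 / real m) / slope r)) * ln (real n)"
        using n3 L1 by (simp add: L_def)
      with p_ge' have p0: "0 < p n" by linarith
      have "1 - real n ^ 2 * exp (- 1) ^ k \<le>
          measure_pmf.prob (random_graph n (p n)) {G. percolation_time n r G \<le> enat (t n)}"
        by (rule prob_percolation_ge[OF r tn(1) n3 p0 _ p_ge'[unfolded m_def] vN[unfolded v_def] N kN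
              b[unfolded v_def m_def]]) (use p in auto)
      moreover have "real n ^ 2 * exp (- 1) ^ k \<le> 1 / real n"
      proof -
        have "exp (- 1) ^ k = exp (- real k)" by (simp add: exp_of_nat_mult[symmetric])
        also have "\<dots> \<le> exp (- (3 * L n))" using k by simp
        also have "\<dots> = 1 / real n ^ 3"
          using n3 exp_of_nat_mult[of 3 "L n"] by (simp add: L_def exp_minus divide_inverse)
        finally have "real n ^ 2 * exp (- 1) ^ k \<le> real n ^ 2 * (1 / real n ^ 3)"
          by (intro mult_left_mono) auto
        also have "\<dots> = 1 / real n" using n3 by (simp add: power2_eq_square power3_eq_cube)
        finally show ?thesis .
      qed
      ultimately show ?case by linarith
    qed
  qed simp
qed

theorem theorem1p1:
  fixes r :: nat
    and t :: "nat \<Rightarrow> nat"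
    and p :: "nat \<Rightarrow> real"
    and \<omega> :: "nat \<Rightarrow> real"
  assumes "r \<ge> 4"
    and "\<And>n. admissible r n \<Longrightarrow>
           1 \<le> t n \<and> real (t n) \<le> ln (ln (real n)) / (3 * ln (tau r))"
    and "\<And>n. 0 \<le> p n \<and> p n \<le> 1"
    and "\<And>n. \<omega> n > 0"
    and "filterlim \<omega> at_top sequentially"
  shows
    "((\<forall>n. admissible r n \<longrightarrow>
         p n \<ge> real n powr (- ((v_num r (t n) - 2) / e_num r (t n))) * ln (real n)) \<longrightarrow>
      (\<lambda>n. measure_pmf.prob (random_graph n (p n)) {G. percolation_time n r G \<le> enat (t n)})
        \<longlonglongrightarrow> 1)
     \<and>
     ((\<forall>n. admissible r n \<longrightarrow>
         p n \<le> real n powr (- ((v_num r (t n) - 2) / e_num r (t n))) / \<omega> n) \<longrightarrow>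
      (\<lambda>n. measure_pmf.prob (random_graph n (p n)) {G. percolation_time n r G \<le> enat (t n)})
        \<longlonglongrightarrow> 0)"
  using prob_percolation_tendsto_1[of r t p] prob_percolation_tendsto_0[of r t p \<omega>] assms by blast

end
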